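(* Let $M \in \{0,1\}^{n\times n}$ and $\Delta \in [0,n]$. Suppose predictions $(\hat v_1,\ldots,\hat v_n)$, with each $\hat v_i\in\{0,1\}^n$, are given such that $EH(\hat v_i,\vec v_i)\le \Delta$ for each online input vector $\vec v_i \in\{0,1\}^n$ ($i=1,\ldots,n$). Then, after preprocessing of $M$ and $(\hat v_1,\ldots,\hat v_n)$ in $O(n^\omega)$ time, each arithmetic (integer) product $M\vec v_i$ can be computed in time $Q(n,\Delta)=O(n(1+\Delta))$ when $\vec v_i$ arrives online. In particular, each Boolean result vector $M\vec v_i$ (Boolean matrix-vector product) can be computed in $O(n(1+\Delta))$ time.
   Context: $\omega$ denotes the matrix multiplication exponent. The extended Hamming distance $EH(s,t)$ of bit strings $s=s_1\ldots s_n,\ t=t_1\ldots t_n\in\{0,1\}^n$ is defined recursively: $EH$ of two empty strings is $0$; otherwise let $\ell\ge 1$ be the largest index such that $s_1=s_2=\cdots=s_\ell$ and $t_1=t_2=\cdots=t_\ell$, and set $EH(s,t) = (s_1+t_1 \bmod 2) + EH(s_{\ell+1}\ldots s_n,\ t_{\ell+1}\ldots t_n)$. In the Online Matrix-Vector (OMv) setting, the matrix $M$ is given for preprocessing, then vectors $\vec v_1,\ldots,\vec v_n$ arrive one at a time and the product $M\vec v_i$ must be output before $\vec v_{i+1}$ is revealed; here the predictions are also available during preprocessing. *)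

theory Defs
  imports Complex_Main "Jordan_Normal_Form.Matrix"
begin

section \<open>Extended Hamming distance\<close>

definition block_len :: "int list \<Rightarrow> int list \<Rightarrow> nat" where
  "block_len s t = (GREATEST l. l \<le> length s \<and> l \<le> length t \<and>
     (\<forall>i<l. s ! i = s ! 0 \<and> t ! i = t ! 0))"

lemma block_len_pos:
  assumes "s \<noteq> []" and "t \<noteq> []"
  shows "1 \<le> block_len s t"
proof -
  let ?P = "\<lambda>l. l \<le> length s \<and> l \<le> length t \<and> (\<forall>i<l. s ! i = s ! 0 \<and> t ! i = t ! 0)"
  have "?P 1" using assms by (auto simp: Suc_le_eq)
  then show ?thesis
    unfolding block_len_def by (rule Greatest_le_nat[where b = "length s"]) auto
qed

text \<open>Only applied to 0/1 lists of equal length.\<close>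

function EH :: "int list \<Rightarrow> int list \<Rightarrow> int" where
  "EH s t = (if s = [] \<or> t = [] then 0
     else (s ! 0 + t ! 0) mod 2 +
       EH (drop (block_len s t) s) (drop (block_len s t) t))"
  by pat_completeness auto
termination
proof (relation "measure (\<lambda>(s, t). length s)", goal_cases)
  case (2 s t)
  then show ?case using block_len_pos[of s t] by (cases s) auto
qed simp

declare EH.simps [simp del]


section \<open>Word RAM\<close>

text \<open>
  The machine is a unit-cost word RAM with structured control flow. Its memory consists of
  integer registers and zero-based integer arrays, both named by natural numbers; a program
  mentions only finitely many of them. (Keeping several arrays side by side in one linear memory
  and replacing jumps by structured control changes running times by constant factors only.)
\<close>

datatype operand = Const int | Reg nat

datatype binop = Add | Sub | Mul | Div | Mod | And | Or | Xor | Less | Equal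

datatype com =
    Skip
  | Op nat binop operand operand  \<comment> \<open>\<open>r := a \<circ> b\<close>\<close>
  | Load nat nat operand          \<comment> \<open>\<open>r := A[i]\<close>\<close>
  | Store nat operand operand     \<comment> \<open>\<open>A[i] := a\<close>\<close>
  | Seq com com
  | Cond operand com com          \<comment> \<open>a nonzero value means true\<close>
  | While operand com

record ram_state =
  reg :: "nat \<Rightarrow> int"
  arr :: "nat \<Rightarrow> nat \<Rightarrow> int"

fun opval :: "ram_state \<Rightarrow> operand \<Rightarrow> int" where
  "opval \<sigma> (Const c) = c"
| "opval \<sigma> (Reg r) = reg \<sigma> r"

fun apply_binop :: "binop \<Rightarrow> int \<Rightarrow> int \<Rightarrow> int" where
  "apply_binop Add a b = a + b"
| "apply_binop Sub a b = a - b"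
| "apply_binop Mul a b = a * b"
| "apply_binop Div a b = a div b"
| "apply_binop Mod a b = a mod b"
| "apply_binop And a b = Bit_Operations.and a b"
| "apply_binop Or a b = Bit_Operations.or a b"
| "apply_binop Xor a b = Bit_Operations.xor a b"
| "apply_binop Less a b = of_bool (a < b)"
| "apply_binop Equal a b = of_bool (a = b)"

text \<open>
  \<open>exec W c \<sigma> t \<sigma>'\<close>: started in \<open>\<sigma>\<close>, program \<open>c\<close> halts in \<open>\<sigma>'\<close> after exactly \<open>t\<close> steps. Every
  value written and every address used has to lie in the word range given by \<open>W\<close>; otherwise
  the machine is stuck and there is no derivation.
\<close>

inductive exec :: "int \<Rightarrow> com \<Rightarrow> ram_state \<Rightarrow> nat \<Rightarrow> ram_state \<Rightarrow> bool" for W :: int where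
  exec_Skip: "exec W Skip \<sigma> 1 \<sigma>"
| exec_Op: "x = apply_binop f (opval \<sigma> a) (opval \<sigma> b) \<Longrightarrow> \<bar>x\<bar> \<le> W \<Longrightarrow>
    exec W (Op r f a b) \<sigma> 1 (\<sigma>\<lparr>reg := (reg \<sigma>)(r := x)\<rparr>)"
| exec_Load: "0 \<le> opval \<sigma> i \<Longrightarrow> opval \<sigma> i \<le> W \<Longrightarrow> x = arr \<sigma> A (nat (opval \<sigma> i)) \<Longrightarrow> \<bar>x\<bar> \<le> W \<Longrightarrow>
    exec W (Load r A i) \<sigma> 1 (\<sigma>\<lparr>reg := (reg \<sigma>)(r := x)\<rparr>)"
| exec_Store: "0 \<le> opval \<sigma> i \<Longrightarrow> opval \<sigma> i \<le> W \<Longrightarrow> x = opval \<sigma> a \<Longrightarrow> \<bar>x\<bar> \<le> W \<Longrightarrow>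
    exec W (Store A i a) \<sigma> 1 (\<sigma>\<lparr>arr := (arr \<sigma>)(A := (arr \<sigma> A)(nat (opval \<sigma> i) := x))\<rparr>)"
| exec_Seq: "exec W c \<sigma> t \<sigma>' \<Longrightarrow> exec W d \<sigma>' u \<sigma>'' \<Longrightarrow> exec W (Seq c d) \<sigma> (t + u) \<sigma>''"
| exec_CondT: "opval \<sigma> a \<noteq> 0 \<Longrightarrow> exec W c \<sigma> t \<sigma>' \<Longrightarrow> exec W (Cond a c d) \<sigma> (t + 1) \<sigma>'"
| exec_CondF: "opval \<sigma> a = 0 \<Longrightarrow> exec W d \<sigma> t \<sigma>' \<Longrightarrow> exec W (Cond a c d) \<sigma> (t + 1) \<sigma>'"
| exec_WhileF: "opval \<sigma> a = 0 \<Longrightarrow> exec W (While a c) \<sigma> 1 \<sigma>"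
| exec_WhileT: "opval \<sigma> a \<noteq> 0 \<Longrightarrow> exec W c \<sigma> t \<sigma>' \<Longrightarrow> exec W (While a c) \<sigma>' u \<sigma>'' \<Longrightarrow>
    exec W (While a c) \<sigma> (t + u + 1) \<sigma>''"

text \<open>
  Words of \<open>O(log n)\<close> bits: on inputs of dimension \<open>n\<close> a program has words of absolute value at
  most \<open>(n + 2) ^ k\<close>, where \<open>k\<close> is a constant belonging to the program. Without such a bound,
  unit-cost arithmetic could multiply whole matrices packed into single integers.
\<close>

definition word_bound :: "nat \<Rightarrow> nat \<Rightarrow> int" where
  "word_bound k n = (int n + 2) ^ k"

text \<open>Row-major layout of an \<open>n \<times> n\<close> array.\<close>

definition row_major :: "nat \<Rightarrow> (nat \<Rightarrow> nat \<Rightarrow> int) \<Rightarrow> nat \<Rightarrow> int" where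
  "row_major n f p = (if p < n * n then f (p div n) (p mod n) else 0)"

text \<open>The dimension is in register 0, the two \<open>n \<times> n\<close> inputs are in arrays 0 and 1, all else is 0.\<close>

definition init_state :: "nat \<Rightarrow> (nat \<Rightarrow> nat \<Rightarrow> int) \<Rightarrow> (nat \<Rightarrow> nat \<Rightarrow> int) \<Rightarrow> ram_state" where
  "init_state n f g = \<lparr>reg = (\<lambda>_. 0)(0 := int n),
     arr = (\<lambda>_ _. 0)(0 := row_major n f, 1 := row_major n g)\<rparr>"


section \<open>The matrix multiplication exponent\<close>

text \<open>
  \<open>n \<times> n\<close> integer matrices with polynomially bounded entries (any fixed polynomial bound) can be
  multiplied in time \<open>O(n^\<tau>)\<close>. The product is delivered in array 2.
\<close>

definition mat_mult_time :: "real \<Rightarrow> bool" where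
  "mat_mult_time \<tau> \<longleftrightarrow> (\<forall>d. \<exists>c k C. \<forall>n\<ge>1. \<forall>A \<in> carrier_mat n n. \<forall>B \<in> carrier_mat n n.
     (\<forall>i<n. \<forall>j<n. \<bar>A $$ (i, j)\<bar> \<le> int n ^ d \<and> \<bar>B $$ (i, j)\<bar> \<le> int n ^ d) \<longrightarrow>
     (\<exists>t \<sigma>. exec (word_bound k n) c
              (init_state n (\<lambda>i j. A $$ (i, j)) (\<lambda>i j. B $$ (i, j))) t \<sigma> \<and>
            real t \<le> C * real n powr \<tau> \<and>
            (\<forall>i<n. \<forall>j<n. arr \<sigma> 2 (i * n + j) = (A * B) $$ (i, j))))"

definition omega :: real where
  "omega = Inf {\<tau>. mat_mult_time \<tau>}"


section \<open>Online matrix-vector multiplication with predictions\<close>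

definition bit_mats :: "nat \<Rightarrow> int mat set" where
  "bit_mats n = {A \<in> carrier_mat n n. \<forall>i<n. \<forall>j<n. A $$ (i, j) \<in> {0, 1}}"

definition bit_vecs :: "nat \<Rightarrow> int vec set" where
  "bit_vecs n = {v \<in> carrier_vec n. \<forall>i<n. v $ i \<in> {0, 1}}"

definition bool_mult_mat_vec :: "int mat \<Rightarrow> int vec \<Rightarrow> int vec" where
  "bool_mult_mat_vec A v =
     vec (dim_row A) (\<lambda>i. of_bool (\<exists>j<dim_vec v. A $$ (i, j) = 1 \<and> v $ j = 1))"

text \<open>
  An online vector is delivered in array 3, everything else in memory being left as it was, and
  the answer is expected in array 4.
\<close>

definition deliver :: "nat \<Rightarrow> int vec \<Rightarrow> ram_state \<Rightarrow> ram_state" where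
  "deliver n v \<sigma> =
     \<sigma>\<lparr>arr := (arr \<sigma>)(3 := (\<lambda>p. if p < n then v $ p else arr \<sigma> 3 p))\<rparr>"

definition answer :: "nat \<Rightarrow> ram_state \<Rightarrow> int vec" where
  "answer n \<sigma> = vec n (arr \<sigma> 4)"

text \<open>
  \<open>P\<close> preprocesses the matrix and the predictions (given as the rows of the second input). Then,
  for each arriving vector, \<open>Q\<close> is run on the memory left by the previous round; so the answer in
  round \<open>i\<close> depends on the vectors of rounds \<open>0, \<dots>, i\<close> only. Neither program is told \<open>\<Delta>\<close>.
\<close>

definition omv_with_predictions ::
  "(int mat \<Rightarrow> int vec \<Rightarrow> int vec) \<Rightarrow> real \<Rightarrow> com \<Rightarrow> com \<Rightarrow> nat \<Rightarrow> real \<Rightarrow> bool" where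
  "omv_with_predictions prd \<tau> P Q k C \<longleftrightarrow>
     (\<forall>n\<ge>1. \<forall>M \<in> bit_mats n. \<forall>v'. (\<forall>i<n. v' i \<in> bit_vecs n) \<longrightarrow>
       (\<exists>t0 \<sigma>0.
          exec (word_bound k n) P (init_state n (\<lambda>i j. M $$ (i, j)) (\<lambda>i j. v' i $ j)) t0 \<sigma>0 \<and>
          real t0 \<le> C * real n powr \<tau> \<and>
          (\<forall>\<Delta>::real. \<forall>v. 0 \<le> \<Delta> \<and> \<Delta> \<le> real n \<and>
             (\<forall>i<n. v i \<in> bit_vecs n \<and>
                real_of_int (EH (list_of_vec (v' i)) (list_of_vec (v i))) \<le> \<Delta>) \<longrightarrow>
             (\<exists>t \<sigma>. \<sigma> 0 = \<sigma>0 \<and>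
               (\<forall>i<n. exec (word_bound k n) Q (deliver n (v i) (\<sigma> i)) (t i) (\<sigma> (Suc i)) \<and>
                  real (t i) \<le> C * (real n * (1 + \<Delta>)) \<and>
                  answer n (\<sigma> (Suc i)) = prd M (v i))))))"

end

theory Submission
  imports Defs
begin

text \<open>
  Let \<open>x = v\<^sub>i - v'\<^sub>i\<close>, a vector with entries in \<open>{-1, 0, 1}\<close> that is constant on each of the blocks
  in the definition of \<open>EH\<close>; its number of jumps (starting from 0) is therefore at most twice
  \<open>EH v'\<^sub>i v\<^sub>i\<close>. If \<open>S\<^sub>j\<close> is the sum of the columns \<open>j, \<dots>, n - 1\<close> of \<open>M\<close>, summation by parts gives
  \<open>M v\<^sub>i = M v'\<^sub>i + (\<Sum>j. (x\<^sub>j - x\<^sub>j\<^sub>-\<^sub>1) S\<^sub>j)\<close>, in which only the jumps contribute, each at cost \<open>O(n)\<close>.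
  The vectors \<open>S\<^sub>j\<close> are tabulated in time \<open>O(n\<^sup>2)\<close>, and all \<open>M v'\<^sub>i\<close> are the columns of one matrix
  product. The quadratic part is absorbed because every multiplication program must write
  \<open>n\<^sup>2\<close> nonzero cells on the all-ones matrices, so that every admissible exponent is at least 2; and
  there are admissible exponents, since the naive algorithm is cubic.
\<close>

section \<open>Timed weakest preconditions and rules for counted loops\<close>

section \<open>Weakest preconditions\<close>

text \<open>Total correctness with the step count handed to the postcondition. The rules for
  loop-free commands are equivalences, so \<open>simp\<close> can execute straight-line code
  symbolically.\<close>

definition wp :: "int \<Rightarrow> com \<Rightarrow> (nat \<Rightarrow> ram_state \<Rightarrow> bool) \<Rightarrow> ram_state \<Rightarrow> bool" where
  "wp W c Q \<sigma> \<longleftrightarrow> (\<exists>t \<sigma>'. exec W c \<sigma> t \<sigma>' \<and> Q t \<sigma>')"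

lemma wp_mono: "wp W c Q \<sigma> \<Longrightarrow> (\<And>t \<sigma>'. Q t \<sigma>' \<Longrightarrow> Q' t \<sigma>') \<Longrightarrow> wp W c Q' \<sigma>"
  by (auto simp: wp_def)

inductive_cases exec_SkipE: "exec W Skip \<sigma> t \<sigma>'"
inductive_cases exec_OpE: "exec W (Op r f a b) \<sigma> t \<sigma>'"
inductive_cases exec_LoadE: "exec W (Load r A i) \<sigma> t \<sigma>'"
inductive_cases exec_StoreE: "exec W (Store A i a) \<sigma> t \<sigma>'"
inductive_cases exec_SeqE: "exec W (Seq c d) \<sigma> t \<sigma>'"
inductive_cases exec_CondE: "exec W (Cond a c d) \<sigma> t \<sigma>'"

lemma wp_Skip [simp]: "wp W Skip Q \<sigma> \<longleftrightarrow> Q 1 \<sigma>"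
proof -
  have "exec W Skip \<sigma> t \<sigma>' \<longleftrightarrow> t = 1 \<and> \<sigma>' = \<sigma>" for t \<sigma>'
    by (auto elim: exec_SkipE intro: exec_Skip simp del: One_nat_def)
  then show ?thesis by (simp add: wp_def)
qed

lemma wp_Op [simp]:
  "wp W (Op r f a b) Q \<sigma> \<longleftrightarrow>
     \<bar>apply_binop f (opval \<sigma> a) (opval \<sigma> b)\<bar> \<le> W \<and>
     Q 1 (\<sigma>\<lparr>reg := (reg \<sigma>)(r := apply_binop f (opval \<sigma> a) (opval \<sigma> b))\<rparr>)"
proof -
  have "exec W (Op r f a b) \<sigma> t \<sigma>' \<longleftrightarrow> \<bar>apply_binop f (opval \<sigma> a) (opval \<sigma> b)\<bar> \<le> W \<and>
      t = 1 \<and> \<sigma>' = \<sigma>\<lparr>reg := (reg \<sigma>)(r := apply_binop f (opval \<sigma> a) (opval \<sigma> b))\<rparr>" for t \<sigma>'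
    by (auto elim!: exec_OpE intro!: exec_Op simp del: One_nat_def)
  then show ?thesis by (simp add: wp_def)
qed

lemma wp_Load [simp]:
  "wp W (Load r A i) Q \<sigma> \<longleftrightarrow>
     0 \<le> opval \<sigma> i \<and> opval \<sigma> i \<le> W \<and> \<bar>arr \<sigma> A (nat (opval \<sigma> i))\<bar> \<le> W \<and>
     Q 1 (\<sigma>\<lparr>reg := (reg \<sigma>)(r := arr \<sigma> A (nat (opval \<sigma> i)))\<rparr>)"
proof -
  have "exec W (Load r A i) \<sigma> t \<sigma>' \<longleftrightarrow>
      0 \<le> opval \<sigma> i \<and> opval \<sigma> i \<le> W \<and> \<bar>arr \<sigma> A (nat (opval \<sigma> i))\<bar> \<le> W \<and>
      t = 1 \<and> \<sigma>' = \<sigma>\<lparr>reg := (reg \<sigma>)(r := arr \<sigma> A (nat (opval \<sigma> i)))\<rparr>" for t \<sigma>'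
    by (auto elim!: exec_LoadE intro!: exec_Load simp del: One_nat_def)
  then show ?thesis by (simp add: wp_def)
qed

lemma wp_Store [simp]:
  "wp W (Store A i a) Q \<sigma> \<longleftrightarrow>
     0 \<le> opval \<sigma> i \<and> opval \<sigma> i \<le> W \<and> \<bar>opval \<sigma> a\<bar> \<le> W \<and>
     Q 1 (\<sigma>\<lparr>arr := (arr \<sigma>)(A := (arr \<sigma> A)(nat (opval \<sigma> i) := opval \<sigma> a))\<rparr>)"
proof -
  have "exec W (Store A i a) \<sigma> t \<sigma>' \<longleftrightarrow>
      0 \<le> opval \<sigma> i \<and> opval \<sigma> i \<le> W \<and> \<bar>opval \<sigma> a\<bar> \<le> W \<and>
      t = 1 \<and> \<sigma>' = \<sigma>\<lparr>arr := (arr \<sigma>)(A := (arr \<sigma> A)(nat (opval \<sigma> i) := opval \<sigma> a))\<rparr>"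
    for t \<sigma>'
    by (auto elim!: exec_StoreE intro!: exec_Store simp del: One_nat_def)
  then show ?thesis by (simp add: wp_def)
qed

lemma wp_Seq [simp]:
  "wp W (Seq c d) Q \<sigma> \<longleftrightarrow> wp W c (\<lambda>t \<sigma>'. wp W d (\<lambda>u. Q (t + u)) \<sigma>') \<sigma>"
  unfolding wp_def by (blast elim: exec_SeqE intro: exec_Seq)

lemma wp_Cond [simp]:
  "wp W (Cond a c d) Q \<sigma> \<longleftrightarrow>
     (if opval \<sigma> a \<noteq> 0 then wp W c (\<lambda>t. Q (t + 1)) \<sigma> else wp W d (\<lambda>t. Q (t + 1)) \<sigma>)"
  unfolding wp_def
  by (auto elim!: exec_CondE intro: exec_CondT exec_CondF)
    (blast intro: exec_CondT[simplified] exec_CondF[simplified])+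

text \<open>The counter runs downwards so that the loop test is just that a register is nonzero. The
  body sees the values \<open>m - 1\<close> down to \<open>0\<close>.\<close>

definition For :: "nat \<Rightarrow> nat \<Rightarrow> com \<Rightarrow> com" where
  "For r m c = Seq (Op r Add (Reg m) (Const 0))
     (While (Reg r) (Seq (Op r Sub (Reg r) (Const 1)) c))"

text \<open>Induction on the counter. In \<open>I i t\<close>, \<open>t\<close> is the time spent so
  far; besides its body a round pays for the test and the decrement, hence the \<open>2\<close>, and
  the failing last test is the \<open>1\<close>.\<close>

lemma wp_countdown:
  assumes step: "\<And>i t \<sigma>. i < m \<Longrightarrow> I (Suc i) t \<sigma> \<Longrightarrow> reg \<sigma> r = int (Suc i) \<Longrightarrow>
      wp W c (\<lambda>u \<sigma>'. reg \<sigma>' r = int i \<and> I i (t + u + 2) \<sigma>') (\<sigma>\<lparr>reg := (reg \<sigma>)(r := int i)\<rparr>)"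
    and W: "int m \<le> W"
    and fin: "\<And>t \<sigma>. I 0 t \<sigma> \<Longrightarrow> reg \<sigma> r = 0 \<Longrightarrow> Q (t + 1) \<sigma>"
  shows "k \<le> m \<Longrightarrow> I k t \<sigma> \<Longrightarrow> reg \<sigma> r = int k \<Longrightarrow>
    wp W (While (Reg r) (Seq (Op r Sub (Reg r) (Const 1)) c)) (\<lambda>u. Q (t + u)) \<sigma>"
proof (induction k arbitrary: t \<sigma>)
  case 0
  have "exec W (While (Reg r) (Seq (Op r Sub (Reg r) (Const 1)) c)) \<sigma> 1 \<sigma>"
    using 0 by (intro exec_WhileF) simp
  with fin[OF 0(2)] 0(3) show ?case unfolding wp_def by (intro exI[of _ 1]) auto
next
  case (Suc k)
  let ?b = "Seq (Op r Sub (Reg r) (Const 1)) c"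
  have "wp W ?b (\<lambda>u \<sigma>'. reg \<sigma>' r = int k \<and> I k (t + u + 1) \<sigma>') \<sigma>"
    using step[of k t \<sigma>] Suc.prems W by (simp add: add.assoc)
  then obtain u \<sigma>' where 1: "exec W ?b \<sigma> u \<sigma>'" "reg \<sigma>' r = int k" "I k (t + u + 1) \<sigma>'"
    by (auto simp: wp_def)
  then have "wp W (While (Reg r) ?b) (\<lambda>u'. Q (t + u + 1 + u')) \<sigma>'"
    using Suc.IH[of "t + u + 1" \<sigma>'] Suc.prems by simp
  then obtain u' \<sigma>'' where 2: "exec W (While (Reg r) ?b) \<sigma>' u' \<sigma>''" "Q (t + u + 1 + u') \<sigma>''"
    by (auto simp: wp_def)
  have "exec W (While (Reg r) ?b) \<sigma> (u + u' + 1) \<sigma>''"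
    using Suc.prems 1(1) 2(1) by (intro exec_WhileT) auto
  with 2(2) show ?case unfolding wp_def by (intro exI[of _ "u + u' + 1"]) (auto simp: ac_simps)
qed

text \<open>Keeping the elapsed time in the invariant allows rounds of data-dependent cost, as in
  the scan of a query, where only jumps are expensive.\<close>

lemma wp_For_timed:
  assumes "reg \<sigma> rm = int m" "int m \<le> W" "I m 0 (\<sigma>\<lparr>reg := (reg \<sigma>)(r := int m)\<rparr>)"
    and "\<And>i t \<sigma>. i < m \<Longrightarrow> I (Suc i) t \<sigma> \<Longrightarrow> reg \<sigma> r = int (Suc i) \<Longrightarrow>
      wp W c (\<lambda>u \<sigma>'. reg \<sigma>' r = int i \<and> I i (t + u + 2) \<sigma>') (\<sigma>\<lparr>reg := (reg \<sigma>)(r := int i)\<rparr>)"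
    and "\<And>t \<sigma>. I 0 t \<sigma> \<Longrightarrow> reg \<sigma> r = 0 \<Longrightarrow> Q (t + 2) \<sigma>"
  shows "wp W (For r rm c) Q \<sigma>"
  using wp_countdown[where c = c and W = W and I = I and r = r and m = m and k = m and t = 0
      and Q = "\<lambda>t. Q (Suc t)" and \<sigma> = "\<sigma>\<lparr>reg := (reg \<sigma>)(r := int m)\<rparr>"] assms
  by (simp add: For_def)

text \<open>The special case of a uniform bound \<open>K\<close> on the body, with the clock removed
  from the invariant.\<close>

lemma wp_For:
  assumes "reg \<sigma> rm = int m" "int m \<le> W" "J m (\<sigma>\<lparr>reg := (reg \<sigma>)(r := int m)\<rparr>)"
    and step: "\<And>i \<sigma>. i < m \<Longrightarrow> J (Suc i) \<sigma> \<Longrightarrow> reg \<sigma> r = int (Suc i) \<Longrightarrow>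
      wp W c (\<lambda>u \<sigma>'. reg \<sigma>' r = int i \<and> J i \<sigma>' \<and> u \<le> K) (\<sigma>\<lparr>reg := (reg \<sigma>)(r := int i)\<rparr>)"
    and fin: "\<And>t \<sigma>. J 0 \<sigma> \<Longrightarrow> reg \<sigma> r = 0 \<Longrightarrow> t \<le> m * (K + 2) + 2 \<Longrightarrow> Q t \<sigma>"
  shows "wp W (For r rm c) Q \<sigma>"
proof (rule wp_For_timed[where I = "\<lambda>i t \<sigma>. J i \<sigma> \<and> t \<le> (m - i) * (K + 2)" and m = m])
  fix i t \<sigma>
  assume i: "i < m" "J (Suc i) \<sigma> \<and> t \<le> (m - Suc i) * (K + 2)" "reg \<sigma> r = int (Suc i)"
  have "(m - i) * (K + 2) = (m - Suc i) * (K + 2) + (K + 2)"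
    using i(1) by (simp flip: Suc_diff_Suc)
  then have t: "t + u + 2 \<le> (m - i) * (K + 2)" if "u \<le> K" for u using i(2) that by linarith
  show "wp W c (\<lambda>u \<sigma>'. reg \<sigma>' r = int i \<and> J i \<sigma>' \<and> t + u + 2 \<le> (m - i) * (K + 2))
      (\<sigma>\<lparr>reg := (reg \<sigma>)(r := int i)\<rparr>)"
    by (rule wp_mono[OF step]) (use i t in auto)
qed (use assms in auto)

text \<open>The word range enters derivations only as an upper bound. Hence a multiplication program
  can be run inside a larger program with a larger word exponent.\<close>

lemma exec_mono_word: "exec W c \<sigma> t \<sigma>' \<Longrightarrow> W \<le> W' \<Longrightarrow> exec W' c \<sigma> t \<sigma>'"
  by (induction rule: exec.induct) (auto intro: exec.intros simp del: One_nat_def)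

lemma word_bound_mono: "k \<le> k' \<Longrightarrow> word_bound k n \<le> word_bound k' n"
  unfolding word_bound_def by (rule power_increasing) auto

section \<open>Frame property: a program neither reads nor writes names outside its finite name
  set\<close>

section \<open>Locality of programs\<close>

fun operand_below :: "nat \<Rightarrow> operand \<Rightarrow> bool" where
  "operand_below b (Const c) \<longleftrightarrow> True"
| "operand_below b (Reg r) \<longleftrightarrow> r < b"

text \<open>Registers and arrays share one bound, so a single \<open>b\<close> separates a given
  multiplication program from all names used around it.\<close>

fun names_below :: "nat \<Rightarrow> com \<Rightarrow> bool" where
  "names_below b Skip \<longleftrightarrow> True"
| "names_below b (Op r f x y) \<longleftrightarrow> r < b \<and> operand_below b x \<and> operand_below b y"
| "names_below b (Load r A i) \<longleftrightarrow> r < b \<and> A < b \<and> operand_below b i"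
| "names_below b (Store A i x) \<longleftrightarrow> A < b \<and> operand_below b i \<and> operand_below b x"
| "names_below b (Seq c d) \<longleftrightarrow> names_below b c \<and> names_below b d"
| "names_below b (Cond x c d) \<longleftrightarrow> operand_below b x \<and> names_below b c \<and> names_below b d"
| "names_below b (While x c) \<longleftrightarrow> operand_below b x \<and> names_below b c"

lemma operand_below_mono: "operand_below b x \<Longrightarrow> b \<le> b' \<Longrightarrow> operand_below b' x"
  by (cases x) auto

lemma names_below_mono: "names_below b c \<Longrightarrow> b \<le> b' \<Longrightarrow> names_below b' c"
  by (induction c) (auto intro: operand_below_mono)

lemma ex_operand_below: "\<exists>b. operand_below b x"
  by (cases x) auto

lemma ex_names_below: "\<exists>b. names_below b c"
proof (induction c)
  case (Op r f x y)
  obtain b1 b2 where "operand_below b1 x" "operand_below b2 y" using ex_operand_below by metis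
  then show ?case by (intro exI[of _ "Suc (r + b1 + b2)"]) (auto elim: operand_below_mono)
next
  case (Load r A i)
  obtain b where "operand_below b i" using ex_operand_below by metis
  then show ?case by (intro exI[of _ "Suc (r + A + b)"]) (auto elim: operand_below_mono)
next
  case (Store A i x)
  obtain b1 b2 where "operand_below b1 i" "operand_below b2 x" using ex_operand_below by metis
  then show ?case by (intro exI[of _ "Suc (A + b1 + b2)"]) (auto elim: operand_below_mono)
next
  case (Seq c d)
  then obtain b1 b2 where "names_below b1 c" "names_below b2 d" by metis
  then show ?case by (intro exI[of _ "b1 + b2"]) (auto elim: names_below_mono)
next
  case (Cond x c d)
  then obtain b1 b2 where "names_below b1 c" "names_below b2 d" by metis
  moreover obtain b3 where "operand_below b3 x" using ex_operand_below by metis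
  ultimately show ?case
    by (intro exI[of _ "b1 + b2 + b3"]) (auto elim: names_below_mono operand_below_mono)
next
  case (While x c)
  then obtain b1 where "names_below b1 c" by metis
  moreover obtain b3 where "operand_below b3 x" using ex_operand_below by metis
  ultimately show ?case
    by (intro exI[of _ "b1 + b3"]) (auto elim: names_below_mono operand_below_mono)
qed auto

definition agree_below :: "nat \<Rightarrow> ram_state \<Rightarrow> ram_state \<Rightarrow> bool" where
  "agree_below b \<sigma> \<tau> \<longleftrightarrow> (\<forall>x<b. reg \<sigma> x = reg \<tau> x \<and> arr \<sigma> x = arr \<tau> x)"

definition agree_above :: "nat \<Rightarrow> ram_state \<Rightarrow> ram_state \<Rightarrow> bool" where
  "agree_above b \<sigma> \<tau> \<longleftrightarrow> (\<forall>x\<ge>b. reg \<sigma> x = reg \<tau> x \<and> arr \<sigma> x = arr \<tau> x)"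

lemma agree_above_refl [simp]: "agree_above b \<sigma> \<sigma>"
  by (simp add: agree_above_def)

lemma agree_above_trans: "agree_above b \<rho> \<sigma> \<Longrightarrow> agree_above b \<sigma> \<tau> \<Longrightarrow> agree_above b \<rho> \<tau>"
  by (simp add: agree_above_def)

lemma opval_agree: "agree_below b \<sigma> \<tau> \<Longrightarrow> operand_below b x \<Longrightarrow> opval \<tau> x = opval \<sigma> x"
  by (cases x) (auto simp: agree_below_def)

text \<open>The same derivation replays step by step, since only names below \<open>b\<close> are
  consulted or changed. This lets a multiplication program run in a memory that holds further data
  above \<open>b\<close>, with the same time and product.\<close>

lemma exec_frame:
  "exec W c \<sigma> t \<sigma>' \<Longrightarrow> names_below b c \<Longrightarrow> agree_below b \<sigma> \<tau> \<Longrightarrow>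
    \<exists>\<tau>'. exec W c \<tau> t \<tau>' \<and> agree_below b \<sigma>' \<tau>' \<and> agree_above b \<tau>' \<tau>"
proof (induction arbitrary: \<tau> rule: exec.induct)
  case (exec_Skip \<sigma>)
  then show ?case by (auto intro: exec.exec_Skip simp del: One_nat_def)
next
  case (exec_Op x f \<sigma> x1 x2 r)
  note [simp] = opval_agree[OF exec_Op.prems(2)]
  have "exec W (Op r f x1 x2) \<tau> 1 (\<tau>\<lparr>reg := (reg \<tau>)(r := x)\<rparr>)"
    using exec_Op by (intro exec.exec_Op) simp_all
  then show ?case
    using exec_Op.prems
    by (intro exI[of _ "\<tau>\<lparr>reg := (reg \<tau>)(r := x)\<rparr>"] conjI)
      (auto simp: agree_below_def agree_above_def simp del: One_nat_def)
next
  case (exec_Load \<sigma> i x A r)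
  note [simp] = opval_agree[OF exec_Load.prems(2)]
  have "exec W (Load r A i) \<tau> 1 (\<tau>\<lparr>reg := (reg \<tau>)(r := x)\<rparr>)"
    using exec_Load by (intro exec.exec_Load) (simp_all add: agree_below_def)
  then show ?case
    using exec_Load.prems
    by (intro exI[of _ "\<tau>\<lparr>reg := (reg \<tau>)(r := x)\<rparr>"] conjI)
      (auto simp: agree_below_def agree_above_def simp del: One_nat_def)
next
  case (exec_Store \<sigma> i x y A)
  note [simp] = opval_agree[OF exec_Store.prems(2)]
  have "exec W (Store A i y) \<tau> 1 (\<tau>\<lparr>arr := (arr \<tau>)(A := (arr \<tau> A)(nat (opval \<tau> i) := x))\<rparr>)"
    using exec_Store by (intro exec.exec_Store) simp_all
  then show ?case
    using exec_Store.prems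
    by (intro exI[of _ "\<tau>\<lparr>arr := (arr \<tau>)(A := (arr \<tau> A)(nat (opval \<tau> i) := x))\<rparr>"] conjI)
      (auto simp: agree_below_def agree_above_def simp del: One_nat_def)
next
  case (exec_Seq c \<sigma> t \<sigma>' d u \<sigma>'')
  then obtain \<tau>' where 1: "exec W c \<tau> t \<tau>'" "agree_below b \<sigma>' \<tau>'" "agree_above b \<tau>' \<tau>"
    by fastforce
  with exec_Seq obtain \<tau>'' where "exec W d \<tau>' u \<tau>''" "agree_below b \<sigma>'' \<tau>''" "agree_above b \<tau>'' \<tau>'"
    by fastforce
  with 1 show ?case by (blast intro: exec.exec_Seq agree_above_trans)
next
  case (exec_CondT \<sigma> a c t \<sigma>' d)
  then obtain \<tau>' where "exec W c \<tau> t \<tau>'" "agree_below b \<sigma>' \<tau>'" "agree_above b \<tau>' \<tau>"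
    by fastforce
  moreover have "opval \<tau> a \<noteq> 0" using exec_CondT opval_agree by auto
  ultimately show ?case by (blast intro: exec.exec_CondT)
next
  case (exec_CondF \<sigma> a d t \<sigma>' c)
  then obtain \<tau>' where "exec W d \<tau> t \<tau>'" "agree_below b \<sigma>' \<tau>'" "agree_above b \<tau>' \<tau>"
    by fastforce
  moreover have "opval \<tau> a = 0" using exec_CondF opval_agree by auto
  ultimately show ?case by (blast intro: exec.exec_CondF)
next
  case (exec_WhileF \<sigma> a c)
  moreover have "opval \<tau> a = 0" using exec_WhileF opval_agree by auto
  ultimately show ?case by (blast intro: exec.exec_WhileF agree_above_refl)
next
  case (exec_WhileT \<sigma> a c t \<sigma>' u \<sigma>'')
  then obtain \<tau>' where 1: "exec W c \<tau> t \<tau>'" "agree_below b \<sigma>' \<tau>'" "agree_above b \<tau>' \<tau>"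
    by fastforce
  with exec_WhileT obtain \<tau>'' where
    "exec W (While a c) \<tau>' u \<tau>''" "agree_below b \<sigma>'' \<tau>''" "agree_above b \<tau>'' \<tau>'"
    by fastforce
  moreover have "opval \<tau> a \<noteq> 0" using exec_WhileT opval_agree by auto
  ultimately show ?case using 1 by (blast intro: exec.exec_WhileT agree_above_trans)
qed

section \<open>Lower bound 2 for admissible exponents, by counting written cells\<close>

section \<open>Multiplication takes quadratic time\<close>

text \<open>A single step alters at most one cell, and changes along a run accumulate at most
  additively.\<close>

lemma exec_changed_cells:
  "exec W c \<sigma> t \<sigma>' \<Longrightarrow>
    finite {p. arr \<sigma>' A p \<noteq> arr \<sigma> A p} \<and> card {p. arr \<sigma>' A p \<noteq> arr \<sigma> A p} \<le> t"
proof (induction rule: exec.induct)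
  case (exec_Store \<sigma> i x a B)
  let ?\<sigma>' = "\<sigma>\<lparr>arr := (arr \<sigma>)(B := (arr \<sigma> B)(nat (opval \<sigma> i) := x))\<rparr>"
  have sub: "{p. arr ?\<sigma>' A p \<noteq> arr \<sigma> A p} \<subseteq> {nat (opval \<sigma> i)}" by (auto split: if_splits)
  then show ?case using card_mono[OF _ sub] finite_subset[OF sub] by simp
next
  case (exec_Seq c \<sigma> t \<sigma>' d u \<sigma>'')
  let ?D = "\<lambda>\<sigma> \<tau>. {p. arr \<tau> A p \<noteq> arr \<sigma> A p}"
  have sub: "?D \<sigma> \<sigma>'' \<subseteq> ?D \<sigma> \<sigma>' \<union> ?D \<sigma>' \<sigma>''" by auto
  have "card (?D \<sigma> \<sigma>'') \<le> card (?D \<sigma> \<sigma>') + card (?D \<sigma>' \<sigma>'')"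
    using exec_Seq.IH by (intro order_trans[OF card_mono[OF _ sub] card_Un_le]) auto
  then show ?case using exec_Seq.IH finite_subset[OF sub] by simp
next
  case (exec_WhileT \<sigma> a c t \<sigma>' u \<sigma>'')
  let ?D = "\<lambda>\<sigma> \<tau>. {p. arr \<tau> A p \<noteq> arr \<sigma> A p}"
  have sub: "?D \<sigma> \<sigma>'' \<subseteq> ?D \<sigma> \<sigma>' \<union> ?D \<sigma>' \<sigma>''" by auto
  have "card (?D \<sigma> \<sigma>'') \<le> card (?D \<sigma> \<sigma>') + card (?D \<sigma>' \<sigma>'')"
    using exec_WhileT.IH by (intro order_trans[OF card_mono[OF _ sub] card_Un_le]) auto
  then show ?case using exec_WhileT.IH finite_subset[OF sub] by simp
qed auto

text \<open>The matrix of \<open>mat_mult_time\<close> with program and constants fixed, so that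
  they can be obtained once and used for all dimensions.\<close>

definition mat_mult_program :: "nat \<Rightarrow> real \<Rightarrow> com \<Rightarrow> nat \<Rightarrow> real \<Rightarrow> bool" where
  "mat_mult_program d \<tau> c k C \<longleftrightarrow> (\<forall>n\<ge>1. \<forall>A \<in> carrier_mat n n. \<forall>B \<in> carrier_mat n n.
     (\<forall>i<n. \<forall>j<n. \<bar>A $$ (i, j)\<bar> \<le> int n ^ d \<and> \<bar>B $$ (i, j)\<bar> \<le> int n ^ d) \<longrightarrow>
     (\<exists>t \<sigma>. exec (word_bound k n) c
              (init_state n (\<lambda>i j. A $$ (i, j)) (\<lambda>i j. B $$ (i, j))) t \<sigma> \<and>
            real t \<le> C * real n powr \<tau> \<and>
            (\<forall>i<n. \<forall>j<n. arr \<sigma> 2 (i * n + j) = (A * B) $$ (i, j))))"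

lemma mat_mult_time_iff: "mat_mult_time \<tau> \<longleftrightarrow> (\<forall>d. \<exists>c k C. mat_mult_program d \<tau> c k C)"
  unfolding mat_mult_time_def mat_mult_program_def ..

lemma mat_mult_programD:
  assumes "mat_mult_program d \<tau> c k C" "n \<ge> 1" "A \<in> carrier_mat n n" "B \<in> carrier_mat n n"
    and "\<And>i j. i < n \<Longrightarrow> j < n \<Longrightarrow> \<bar>A $$ (i, j)\<bar> \<le> int n ^ d"
    and "\<And>i j. i < n \<Longrightarrow> j < n \<Longrightarrow> \<bar>B $$ (i, j)\<bar> \<le> int n ^ d"
  obtains t \<sigma> where
    "exec (word_bound k n) c (init_state n (\<lambda>i j. A $$ (i, j)) (\<lambda>i j. B $$ (i, j))) t \<sigma>"
    "real t \<le> C * real n powr \<tau>" "\<forall>i<n. \<forall>j<n. arr \<sigma> 2 (i * n + j) = (A * B) $$ (i, j)"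
proof -
  note H = assms(1)[unfolded mat_mult_program_def, THEN spec, THEN mp, OF assms(2),
    THEN bspec, OF assms(3), THEN bspec, OF assms(4), THEN mp]
  have "\<forall>i<n. \<forall>j<n. \<bar>A $$ (i, j)\<bar> \<le> int n ^ d \<and> \<bar>B $$ (i, j)\<bar> \<le> int n ^ d"
    using assms(5,6) by blast
  from H[OF this] that show thesis by blast
qed

text \<open>All \<open>n^2\<close> result cells change on all-ones matrices, so
  \<open>n^2 \<le> C * n^\<tau>\<close> for every \<open>n \<ge> 1\<close>; an exponent below 2
  would make the unbounded quantity \<open>n^(2 - \<tau>)\<close> at most \<open>C\<close>.\<close>

lemma mat_mult_time_ge_2:
  assumes "mat_mult_time \<tau>"
  shows "2 \<le> \<tau>"
proof (rule ccontr)
  assume "\<not> 2 \<le> \<tau>"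
  obtain c k C where H: "mat_mult_program 0 \<tau> c k C"
    using assms unfolding mat_mult_time_iff by blast
  have bound: "real n powr (2 - \<tau>) \<le> C" if n: "n \<ge> 1" for n
  proof -
    define A :: "int mat" where "A = mat n n (\<lambda>_. 1)"
    have A: "A \<in> carrier_mat n n" "\<And>i j. i < n \<Longrightarrow> j < n \<Longrightarrow> A $$ (i, j) = 1"
      by (auto simp: A_def)
    obtain t \<sigma> where \<sigma>:
      "exec (word_bound k n) c (init_state n (\<lambda>i j. A $$ (i, j)) (\<lambda>i j. A $$ (i, j))) t \<sigma>"
      "real t \<le> C * real n powr \<tau>" "\<forall>i<n. \<forall>j<n. arr \<sigma> 2 (i * n + j) = (A * A) $$ (i, j)"
      by (rule mat_mult_programD[OF H n A(1) A(1)]) (use A(2) in auto)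
    let ?D = "{p. arr \<sigma> 2 p \<noteq> arr (init_state n (\<lambda>i j. A $$ (i, j)) (\<lambda>i j. A $$ (i, j))) 2 p}"
    have "{..<n * n} \<subseteq> ?D"
    proof
      fix p assume "p \<in> {..<n * n}"
      then have p: "p div n < n" "p mod n < n" "p div n * n + p mod n = p"
        using n by (auto simp: less_mult_imp_div_less)
      have "arr \<sigma> 2 p = (A * A) $$ (p div n, p mod n)" using \<sigma>(3) p by metis
      also have "\<dots> = int n" using p(1,2) by (simp add: A_def scalar_prod_def)
      finally show "p \<in> ?D" using n by (simp add: init_state_def)
    qed
    then have "n * n \<le> t"
      using exec_changed_cells[OF \<sigma>(1), of 2] card_mono[of ?D "{..<n * n}"] by simp
    then have "real n * real n \<le> C * real n powr \<tau>" using \<sigma>(2) by (metis of_nat_le_iff of_nat_mult order_trans)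
    moreover have "real n * real n = real n powr (2 - \<tau>) * real n powr \<tau>"
      using n by (simp flip: powr_add add: power2_eq_square)
    ultimately show ?thesis using n by simp
  qed
  \<comment> \<open>Solves \<open>y powr (2 - \<tau>) = \<bar>C\<bar> + 1\<close>, a value that is
    positive and exceeds \<open>C\<close>; any \<open>n\<close> above \<open>y\<close> then
    contradicts \<open>bound\<close>.\<close>
  define y where "y = (\<bar>C\<bar> + 1) powr (1 / (2 - \<tau>))"
  obtain n where n: "y < real n" using reals_Archimedean2 by blast
  have "y > 0" by (simp add: y_def)
  then have "y powr (2 - \<tau>) < real n powr (2 - \<tau>)"
    using n \<open>\<not> 2 \<le> \<tau>\<close> by (intro powr_less_mono2) auto
  moreover have "y powr (2 - \<tau>) = \<bar>C\<bar> + 1" using \<open>\<not> 2 \<le> \<tau>\<close> by (simp add: y_def powr_powr)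
  moreover have "n \<ge> 1" using n \<open>y > 0\<close> by (cases n) auto
  ultimately show False using bound[of n] by simp
qed

lemma nat_index [simp]: "nat (int i * int n + int j) = i * n + j"
  by (metis nat_int of_nat_add of_nat_mult)

lemma index_bound: "i < n \<Longrightarrow> j < n \<Longrightarrow> i * n + j < n * (n::nat)"
proof -
  assume "i < n" "j < n"
  then have "i * n + j < Suc i * n" by simp
  also have "\<dots> \<le> n * n" using \<open>i < n\<close> by (intro mult_le_mono1) simp
  finally show ?thesis .
qed

lemma index_bound_int: "i < n \<Longrightarrow> j < n \<Longrightarrow> int i * int n + int j < int n * int n"
  using index_bound[of i n j] by (metis of_nat_add of_nat_less_iff of_nat_mult)

lemma row_major_index [simp]: "i < n \<Longrightarrow> j < n \<Longrightarrow> row_major n f (i * n + j) = f i j"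
  by (simp add: row_major_def index_bound)

section \<open>The cubic algorithm, verified on the machine\<close>

section \<open>Naive multiplication\<close>

text \<open>One summand of an entry: registers 2, 3 and 4 hold row, column and summation index, 5 is
  the address, 6 and 7 the factors, 8 the accumulator.\<close>

definition inner_product :: com where
  "inner_product =
     Seq (Op 5 Mul (Reg 2) (Reg 0)) (Seq (Op 5 Add (Reg 5) (Reg 4)) (Seq (Load 6 0 (Reg 5))
     (Seq (Op 5 Mul (Reg 4) (Reg 0)) (Seq (Op 5 Add (Reg 5) (Reg 3)) (Seq (Load 7 1 (Reg 5))
     (Seq (Op 6 Mul (Reg 6) (Reg 7)) (Op 8 Add (Reg 8) (Reg 6))))))))"

definition naive_mult :: com where
  "naive_mult = Seq (Op 9 Mul (Reg 0) (Reg 0)) (For 10 9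
     (Seq (Op 2 Div (Reg 10) (Reg 0)) (Seq (Op 3 Mod (Reg 10) (Reg 0)) (Seq (Op 8 Add (Const 0) (Const 0))
     (Seq (For 4 0 inner_product) (Store 2 (Reg 10) (Reg 8)))))))"

text \<open>The word range must accommodate addresses, the inputs, and all partial sums of an entry,
  which are at most \<open>n * D^2\<close> in absolute value.\<close>

lemma wp_naive_mult:
  fixes f g :: "nat \<Rightarrow> nat \<Rightarrow> int"
  assumes n: "n \<ge> 1" and f: "\<And>i j. i < n \<Longrightarrow> j < n \<Longrightarrow> \<bar>f i j\<bar> \<le> D"
    and g: "\<And>i j. i < n \<Longrightarrow> j < n \<Longrightarrow> \<bar>g i j\<bar> \<le> D"
    and W: "int n * int n \<le> W" "D \<le> W" "int n * (D * D) \<le> W"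
  shows "wp W naive_mult (\<lambda>t \<sigma>. t \<le> n * n * (n * 10 + 9) + 3 \<and>
      (\<forall>i<n. \<forall>j<n. arr \<sigma> 2 (i * n + j) = (\<Sum>k<n. f i k * g k j))) (init_state n f g)"
proof -
  have n2: "int n \<le> int n * int n" using n by simp
  have D: "0 \<le> D" using f[of 0 0] n by simp
  have DD: "D * D \<le> W" using n D W(3) mult_right_mono[of 1 "int n" "D * D"] by simp
  have fg: "\<bar>f i k * g k j\<bar> \<le> D * D" if "i < n" "j < n" "k < n" for i j k
    unfolding abs_mult using f g that D by (intro mult_mono) auto
  \<comment> \<open>The inner loop counts down, so the accumulator always holds a tail sum from
    \<open>m\<close> to \<open>n - 1\<close>.\<close>
  have sum: "\<bar>\<Sum>k=m..<n. f i k * g k j\<bar> \<le> W" if "i < n" "j < n" for i j m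
  proof -
    have "\<bar>\<Sum>k=m..<n. f i k * g k j\<bar> \<le> (\<Sum>k=m..<n. \<bar>f i k * g k j\<bar>)" by (rule sum_abs)
    also have "\<dots> \<le> (\<Sum>k=m..<n. D * D)" using fg that by (intro sum_mono) auto
    also have "\<dots> = int (n - m) * (D * D)" by simp
    also have "\<dots> \<le> int n * (D * D)" using D by (intro mult_right_mono) auto
    finally show ?thesis using W by simp
  qed
  define inputs where "inputs \<sigma> \<longleftrightarrow> reg \<sigma> 0 = int n \<and> arr \<sigma> 0 = row_major n f \<and> arr \<sigma> 1 = row_major n g"
    for \<sigma> :: ram_state
  have inner: "wp W (For 4 0 inner_product) (\<lambda>t \<sigma>'. t \<le> n * 10 + 2 \<and> inputs \<sigma>' \<and>
      reg \<sigma>' 10 = reg \<sigma> 10 \<and> arr \<sigma>' 2 = arr \<sigma> 2 \<and> reg \<sigma>' 8 = (\<Sum>k<n. f i k * g k j)) \<sigma>"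
    if \<sigma>: "inputs \<sigma>" "reg \<sigma> 2 = int i" "reg \<sigma> 3 = int j" "reg \<sigma> 8 = 0" and ij: "i < n" "j < n"
    for \<sigma> i j
  proof (rule wp_For[where m = n and K = 8 and J = "\<lambda>m \<sigma>'. inputs \<sigma>' \<and>
      reg \<sigma>' 2 = int i \<and> reg \<sigma>' 3 = int j \<and>
      reg \<sigma>' 10 = reg \<sigma> 10 \<and> arr \<sigma>' 2 = arr \<sigma> 2 \<and> reg \<sigma>' 8 = (\<Sum>k=m..<n. f i k * g k j)"])
    fix k \<sigma>'
    assume k: "k < n" and J: "inputs \<sigma>' \<and>
      reg \<sigma>' 2 = int i \<and> reg \<sigma>' 3 = int j \<and>
      reg \<sigma>' 10 = reg \<sigma> 10 \<and> arr \<sigma>' 2 = arr \<sigma> 2 \<and> reg \<sigma>' 8 = (\<Sum>k=Suc k..<n. f i k * g k j)"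
    have b: "int i * int n \<le> W" "int i * int n + int k \<le> W" "int k * int n \<le> W"
      "int k * int n + int j \<le> W"
      using index_bound_int[of i n k] index_bound_int[of k n j] ij k W by linarith+
    have v: "\<bar>f i k\<bar> \<le> W" "\<bar>g k j\<bar> \<le> W" "\<bar>f i k * g k j\<bar> \<le> W"
      using f[of i k] g[of k j] fg[of i j k] ij k W DD by linarith+
    have s: "(\<Sum>k=Suc k..<n. f i k * g k j) + f i k * g k j = (\<Sum>k=k..<n. f i k * g k j)"
      using k by (simp add: sum.atLeast_Suc_lessThan)
    show "wp W inner_product (\<lambda>u \<sigma>''. reg \<sigma>'' 4 = int k \<and> (inputs \<sigma>'' \<and>
      reg \<sigma>'' 2 = int i \<and> reg \<sigma>'' 3 = int j \<and>
      reg \<sigma>'' 10 = reg \<sigma> 10 \<and> arr \<sigma>'' 2 = arr \<sigma> 2 \<and> reg \<sigma>'' 8 = (\<Sum>k=k..<n. f i k * g k j)) \<and> u \<le> 8)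
      (\<sigma>'\<lparr>reg := (reg \<sigma>')(4 := int k)\<rparr>)"
      using J b v s ij k sum[of i j k] by (simp add: inner_product_def inputs_def)
  qed (use \<sigma> W n2 in \<open>auto simp: inputs_def atLeast0LessThan\<close>)
  let ?J = "\<lambda>m \<sigma>. inputs \<sigma> \<and> (\<forall>p. m \<le> p \<and> p < n * n \<longrightarrow>
      arr \<sigma> 2 p = (\<Sum>k<n. f (p div n) k * g k (p mod n)))"
  have outer: "wp W (For 10 9
     (Seq (Op 2 Div (Reg 10) (Reg 0)) (Seq (Op 3 Mod (Reg 10) (Reg 0)) (Seq (Op 8 Add (Const 0) (Const 0))
     (Seq (For 4 0 inner_product) (Store 2 (Reg 10) (Reg 8)))))))
     (\<lambda>t \<sigma>. t \<le> n * n * (n * 10 + 8) + 2 \<and> ?J 0 \<sigma>) \<sigma>"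
    if \<sigma>: "inputs \<sigma>" "reg \<sigma> 9 = int (n * n)" for \<sigma>
  proof (rule wp_For[where m = "n * n" and K = "n * 10 + 6" and J = ?J])
    fix p \<sigma>
    assume p: "p < n * n" and J: "?J (Suc p) \<sigma>"
    have ij: "p div n < n" "p mod n < n" using p n by (auto simp: less_mult_imp_div_less)
    have "int p < int n * int n" "int p div int n < int n" "int p mod int n < int n"
      using ij p n by (simp_all flip: zdiv_int of_nat_mult)
    moreover have "0 \<le> int p div int n" "0 \<le> int p mod int n"
      by (simp_all flip: zdiv_int zmod_int)
    ultimately have b: "int p \<le> W" "\<bar>int p div int n\<bar> \<le> W" "\<bar>int p mod int n\<bar> \<le> W"
      using W n2 by linarith+
    have s: "\<bar>\<Sum>k<n. f (p div n) k * g k (p mod n)\<bar> \<le> W"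
      using sum[OF ij, of 0] by (simp add: atLeast0LessThan)
    show "wp W (Seq (Op 2 Div (Reg 10) (Reg 0)) (Seq (Op 3 Mod (Reg 10) (Reg 0)) (Seq (Op 8 Add (Const 0) (Const 0))
     (Seq (For 4 0 inner_product) (Store 2 (Reg 10) (Reg 8))))))
     (\<lambda>u \<sigma>'. reg \<sigma>' 10 = int p \<and> ?J p \<sigma>' \<and> u \<le> n * 10 + 6) (\<sigma>\<lparr>reg := (reg \<sigma>)(10 := int p)\<rparr>)"
      using J b W n2
      apply (simp add: inputs_def)
      apply (rule wp_mono[OF inner[where i = "p div n" and j = "p mod n"]])
      using ij b s
      apply (simp_all add: inputs_def zdiv_int zmod_int)
      done
  qed (use \<sigma> W n2 in \<open>auto simp: inputs_def add.commute\<close>)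
  have mono: "t \<le> n * n * (n * 10 + 9) + 2" if "t \<le> n * n * (n * 10 + 8) + 2" for t
    using that by (rule order_trans) simp
  show ?thesis
    unfolding naive_mult_def
    apply (simp add: init_state_def W)
    apply (rule wp_mono[OF outer])
    using W n mono apply (auto simp: inputs_def index_bound)
    done
qed

text \<open>Makes the set of admissible exponents nonempty, without which its infimum would carry no
  information.\<close>

lemma mat_mult_time_3: "mat_mult_time 3"
  unfolding mat_mult_time_iff
proof
  fix d
  \<comment> \<open>The exponent \<open>2 * d + 2\<close> covers partial sums up to
    \<open>n ^ (2 * d + 1)\<close> and, for \<open>d = 0\<close> too, addresses up to
    \<open>n^2\<close>. The constant is \<open>10 + 9 + 3\<close>, after raising all lower powers of
    \<open>n\<close> to the cube.\<close>
  have "mat_mult_program d 3 naive_mult (2 * d + 2) 22"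
    unfolding mat_mult_program_def
  proof (intro allI ballI impI)
    fix n and A B :: "int mat"
    assume n: "1 \<le> n" and A: "A \<in> carrier_mat n n" and B: "B \<in> carrier_mat n n"
      and AB: "\<forall>i<n. \<forall>j<n. \<bar>A $$ (i, j)\<bar> \<le> int n ^ d \<and> \<bar>B $$ (i, j)\<bar> \<le> int n ^ d"
    have pw: "int n ^ e \<le> word_bound (2 * d + 2) n" if "e \<le> 2 * d + 2" for e
      unfolding word_bound_def
      using power_mono[of "int n" "int n + 2" e] power_increasing[OF that, of "int n + 2"] by simp
    have "wp (word_bound (2 * d + 2) n) naive_mult (\<lambda>t \<sigma>. t \<le> n * n * (n * 10 + 9) + 3 \<and>
        (\<forall>i<n. \<forall>j<n. arr \<sigma> 2 (i * n + j) = (\<Sum>k<n. A $$ (i, k) * B $$ (k, j))))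
        (init_state n (\<lambda>i j. A $$ (i, j)) (\<lambda>i j. B $$ (i, j)))"
    proof (rule wp_naive_mult[where D = "int n ^ d"])
      have "int n * (int n ^ d * int n ^ d) = int n ^ (2 * d + 1)"
        by (simp flip: power_add mult_2)
      then show "int n * (int n ^ d * int n ^ d) \<le> word_bound (2 * d + 2) n"
        using pw[of "2 * d + 1"] by linarith
      show "int n * int n \<le> word_bound (2 * d + 2) n"
        using pw[of 2] by (simp add: power2_eq_square)
    qed (use AB n pw[of d] in auto)
    then obtain t \<sigma> where
      \<sigma>: "exec (word_bound (2 * d + 2) n) naive_mult
        (init_state n (\<lambda>i j. A $$ (i, j)) (\<lambda>i j. B $$ (i, j))) t \<sigma>"
      and t: "t \<le> n * n * (n * 10 + 9) + 3"
      and res: "\<forall>i<n. \<forall>j<n. arr \<sigma> 2 (i * n + j) = (\<Sum>k<n. A $$ (i, k) * B $$ (k, j))"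
      by (auto simp: wp_def)
    have "n * n \<le> n * n * n" "1 \<le> n * n * n" using n by auto
    moreover have "n * n * (n * 10 + 9) + 3 = 10 * (n * n * n) + 9 * (n * n) + 3"
      by (simp add: algebra_simps)
    ultimately have "t \<le> 22 * (n * n * n)" using t by linarith
    then have "real t \<le> real (22 * (n * n * n))" by (rule of_nat_mono)
    also have "\<dots> = 22 * real n powr 3" using n by (simp add: powr_numeral power3_eq_cube)
    finally show "\<exists>t \<sigma>. exec (word_bound (2 * d + 2) n) naive_mult
              (init_state n (\<lambda>i j. A $$ (i, j)) (\<lambda>i j. B $$ (i, j))) t \<sigma> \<and>
            real t \<le> 22 * real n powr 3 \<and>
            (\<forall>i<n. \<forall>j<n. arr \<sigma> 2 (i * n + j) = (A * B) $$ (i, j))"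
      using \<sigma> res A B by (intro exI[of _ t] exI[of _ \<sigma>])
        (auto simp: scalar_prod_def atLeast0LessThan)
  qed
  then show "\<exists>c k C. mat_mult_program d 3 c k C" by blast
qed

section \<open>Jumps of the difference vector are at most twice the extended Hamming
  distance\<close>

section \<open>Extended Hamming distance and jumps\<close>

text \<open>The argument \<open>p\<close> plays the entry before the list, so that a start away from
  \<open>p\<close> counts as a jump.\<close>

fun changes :: "int \<Rightarrow> int list \<Rightarrow> nat" where
  "changes p [] = 0"
| "changes p (x # xs) = of_bool (x \<noteq> p) + changes x xs"

lemma changes_le: "changes p xs \<le> of_bool (p \<noteq> q) + changes q xs"
  by (cases xs) auto

text \<open>Within a constant stretch nothing changes, so only its entry can count. With an empty
  stretch this is the cost of replacing the start value.\<close>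

lemma changes_append_const:
  "(\<And>x. x \<in> set xs \<Longrightarrow> x = d) \<Longrightarrow> changes p (xs @ ys) \<le> of_bool (d \<noteq> p) + changes d ys"
proof (induction xs arbitrary: p)
  case Nil
  then show ?case using changes_le[of p ys d] by auto
next
  case (Cons x xs)
  then show ?case using Cons.IH[of d] by auto
qed

lemma changes_eq_sum:
  "changes p xs = (\<Sum>j<length xs. of_bool (xs ! j \<noteq> (p # xs) ! j))"
proof (induction xs arbitrary: p)
  case (Cons x xs)
  then show ?case unfolding changes.simps length_Cons sum.lessThan_Suc_shift by simp
qed simp

text \<open>Length 0 satisfies the conditions vacuously and all candidates are bounded, so the
  greatest one exists and satisfies them.\<close>

lemma block_len_props:
  "block_len s t \<le> length s \<and> block_len s t \<le> length t \<and>
    (\<forall>i<block_len s t. s ! i = s ! 0 \<and> t ! i = t ! 0)"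
  unfolding block_len_def by (rule GreatestI_nat[where k = 0 and b = "length s"]) auto

text \<open>Induction over the blocks. A block where the strings differ adds 1 to the distance and
  costs at most two jumps, one into it and one charged for returning to 0; an agreeing block costs
  nothing beyond what is already charged.\<close>

lemma changes_le_EH:
  assumes "length s = length t" "set s \<subseteq> {0, 1}" "set t \<subseteq> {0, 1}"
  shows "int (changes 0 (map2 (-) t s)) \<le> 2 * EH s t"
  using assms
proof (induction s t rule: EH.induct)
  case (1 s t)
  show ?case
  proof (cases "s = []")
    case True
    then show ?thesis by (subst EH.simps) simp
  next
    case False
    then have ne: "s \<noteq> []" "t \<noteq> []" using "1.prems"(1) by auto
    let ?l = "block_len s t" and ?xs = "map2 (-) t s" and ?d = "t ! 0 - s ! 0"
    let ?rest = "map2 (-) (drop ?l t) (drop ?l s)"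
    note l = block_len_props[of s t]
    have split: "?xs = take ?l ?xs @ ?rest"
      unfolding drop_zip[symmetric] drop_map[symmetric] append_take_drop_id ..
    have "x = ?d" if "x \<in> set (take ?l ?xs)" for x
    proof -
      obtain i where i: "i < ?l" "i < length s" "i < length t" "x = t ! i - s ! i"
        using \<open>x \<in> set (take ?l ?xs)\<close> by (auto simp: in_set_conv_nth)
      with l have "s ! i = s ! 0" "t ! i = t ! 0" by blast+
      with i show ?thesis by simp
    qed
    then have "changes 0 (take ?l ?xs @ ?rest) \<le> of_bool (?d \<noteq> 0) + changes ?d ?rest"
      by (rule changes_append_const)
    then have "changes 0 ?xs \<le> of_bool (?d \<noteq> 0) + changes ?d ?rest"
      unfolding split[symmetric] .
    \<comment> \<open>Resetting the start value to 0 brings the tail into the form of the induction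
      hypothesis.\<close>
    moreover have "changes ?d ?rest \<le> of_bool (?d \<noteq> 0) + changes 0 ?rest"
      by (rule changes_le)
    moreover have "int (changes 0 ?rest) \<le> 2 * EH (drop ?l s) (drop ?l t)"
    proof (rule "1.IH")
      show "set (drop ?l s) \<subseteq> {0, 1}" "set (drop ?l t) \<subseteq> {0, 1}"
        using "1.prems"(2,3) set_drop_subset by fast+
    qed (use ne "1.prems"(1) in auto)
    \<comment> \<open>For bits, the parity of the sum is 1 exactly when they differ.\<close>
    moreover have "int (of_bool (?d \<noteq> 0)) = (s ! 0 + t ! 0) mod 2"
    proof -
      have "s ! 0 \<in> set s" "t ! 0 \<in> set t" using ne by auto
      then have "s ! 0 \<in> {0, 1}" "t ! 0 \<in> {0, 1}" using "1.prems"(2,3) by blast+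
      then show ?thesis by auto
    qed
    moreover have "EH s t = (s ! 0 + t ! 0) mod 2 + EH (drop ?l s) (drop ?l t)"
      using ne by (subst EH.simps) simp
    ultimately show ?thesis by linarith
  qed
qed

section \<open>Suffix sums, a copy of the predictions, and their transpose\<close>

section \<open>Preprocessing\<close>

text \<open>
  All names used besides the interface are at least \<open>b\<close>, out of reach of the multiplication program.
  Array \<open>b\<close> keeps the predictions and array \<open>b + 3\<close> the suffix sums, row \<open>j\<close> being \<open>S\<^sub>j\<close>. Register \<open>b\<close>
  holds the dimension and register \<open>b + 12\<close> the number of the current round.
\<close>

definition tabulate :: "nat \<Rightarrow> com" where
  "tabulate b =
     Seq (Load (b+5) 1 (Reg (b+11))) (Seq (Store b (Reg (b+11)) (Reg (b+5)))
     (Seq (Op (b+3) Div (Reg (b+11)) (Reg b)) (Seq (Op (b+4) Mod (Reg (b+11)) (Reg b))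
     (Seq (Op (b+7) Add (Reg (b+11)) (Reg b)) (Seq (Load (b+5) (b+3) (Reg (b+7)))
     (Seq (Op (b+7) Mul (Reg (b+4)) (Reg b)) (Seq (Op (b+7) Add (Reg (b+7)) (Reg (b+3)))
     (Seq (Load (b+6) 0 (Reg (b+7))) (Seq (Op (b+5) Add (Reg (b+5)) (Reg (b+6)))
     (Store (b+3) (Reg (b+11)) (Reg (b+5))))))))))))"

text \<open>Predictions arrive as rows, but the second factor needs them as columns. Reading from
  the copy in array \<open>b\<close> makes it safe to overwrite array 1.\<close>

definition transpose_cell :: "nat \<Rightarrow> com" where
  "transpose_cell b =
     Seq (Op (b+3) Div (Reg (b+11)) (Reg b)) (Seq (Op (b+4) Mod (Reg (b+11)) (Reg b))
     (Seq (Op (b+7) Mul (Reg (b+4)) (Reg b)) (Seq (Op (b+7) Add (Reg (b+7)) (Reg (b+3)))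
     (Seq (Load (b+5) b (Reg (b+7))) (Store 1 (Reg (b+11)) (Reg (b+5)))))))"

text \<open>The dimension is saved first because the multiplication program may overwrite register
  0.\<close>

definition build_tables :: "nat \<Rightarrow> com" where
  "build_tables b =
     Seq (Op b Add (Reg 0) (Const 0)) (Seq (Op (b+8) Mul (Reg 0) (Reg 0))
     (Seq (For (b+11) (b+8) (tabulate b)) (For (b+11) (b+8) (transpose_cell b))))"

text \<open>Mentions names from \<open>b\<close> upwards only, and is therefore preserved by the
  multiplication program.\<close>

definition tables :: "nat \<Rightarrow> (nat \<Rightarrow> nat \<Rightarrow> int) \<Rightarrow> (nat \<Rightarrow> nat \<Rightarrow> int) \<Rightarrow> nat \<Rightarrow> ram_state \<Rightarrow> bool" where
  "tables n f g b \<sigma> \<longleftrightarrow> reg \<sigma> b = int n \<and>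
     (\<forall>i<n. \<forall>j<n. arr \<sigma> b (i * n + j) = g i j) \<and>
     (\<forall>j<n. \<forall>a<n. arr \<sigma> (b+3) (j * n + a) = (\<Sum>k=j..<n. f a k))"

lemma sum_bits_bounds:
  fixes h :: "nat \<Rightarrow> int"
  assumes "\<And>k. k \<in> {j..<n} \<Longrightarrow> h k \<in> {0, 1}"
  shows "0 \<le> (\<Sum>k=j..<n. h k) \<and> (\<Sum>k=j..<n. h k) \<le> int n"
proof
  have "h k \<ge> 0" "h k \<le> 1" if "k \<in> {j..<n}" for k using assms[OF that] by auto
  then show "0 \<le> (\<Sum>k=j..<n. h k)" by (intro sum_nonneg) auto
  have "(\<Sum>k=j..<n. h k) \<le> (\<Sum>k=j..<n. 1)" by (intro sum_mono) fact
  then show "(\<Sum>k=j..<n. h k) \<le> int n" by simp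
qed

text \<open>The first loop uses \<open>S_j = S_(j+1) + column j\<close>, with \<open>S_(j+1)\<close>
  found \<open>n\<close> cells further on. Afterwards the memory below \<open>b\<close> is
  indistinguishable from a fresh start on \<open>f\<close> and the transposed predictions, which is
  what the frame property requires.\<close>

lemma wp_build_tables:
  fixes f g :: "nat \<Rightarrow> nat \<Rightarrow> int"
  assumes n: "n \<ge> 1" and b: "b \<ge> 5"
    and f: "\<And>i j. i < n \<Longrightarrow> j < n \<Longrightarrow> f i j \<in> {0, 1}"
    and g: "\<And>i j. i < n \<Longrightarrow> j < n \<Longrightarrow> g i j \<in> {0, 1}"
    and W: "int n * int n + 4 * int n + 4 \<le> W"
  shows "wp W (build_tables b) (\<lambda>t \<sigma>. t \<le> n * n * 21 + 6 \<and> tables n f g b \<sigma> \<and> reg \<sigma> (b+12) = 0 \<and>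
      agree_below b (init_state n f (\<lambda>i j. g j i)) \<sigma>) (init_state n f g)"
proof -
  let ?init = "init_state n f g"
  let ?S = "\<lambda>p. \<Sum>k=p div n..<n. f (p mod n) k"
  let ?G = "\<lambda>p. g (p div n) (p mod n)"
  have nn: "0 \<le> int n * int n" by simp
  have W1: "int n * int n \<le> W" "int n \<le> W" "1 \<le> W" "0 \<le> W" using W nn by linarith+
  have p_facts: "int p + int n \<le> W" "p div n < n" "p mod n < n"
    "int (p mod n) * int n + int (p div n) \<le> W" "int (p mod n) * int n \<le> W"
    "int (p div n) \<le> W" "int (p mod n) \<le> W"
    if "p < n * n" for p
  proof -
    show ij: "p div n < n" "p mod n < n" using that n by (auto simp: less_mult_imp_div_less)
    have "int p < int n * int n" using that by (simp flip: of_nat_mult)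
    then show "int p + int n \<le> W" using W by linarith
    show "int (p mod n) * int n + int (p div n) \<le> W" "int (p mod n) * int n \<le> W"
      using index_bound_int[of "p mod n" n "p div n"] ij W by linarith+
    show "int (p div n) \<le> W" "int (p mod n) \<le> W" using ij W nn by linarith+
  qed
  have gW: "\<bar>g i j\<bar> \<le> W" and fW: "\<bar>f i j\<bar> \<le> W" if "i < n" "j < n" for i j
    using f[OF that] g[OF that] W1 by auto
  have SW: "\<bar>\<Sum>k=j..<n. f a k\<bar> \<le> W" if "a < n" for a j
    using sum_bits_bounds[of j n "f a"] f that W1 by fastforce
  \<comment> \<open>The suffix sums are described up to \<open>n * n + n\<close>: the extra row
    \<open>n\<close> is the empty sum \<open>S_n = 0\<close>, read when row \<open>n - 1\<close> is
    computed and supplied by the initial zeros.\<close>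
  define J1 where "J1 m \<sigma> \<longleftrightarrow> reg \<sigma> b = int n \<and> reg \<sigma> (b+8) = int (n * n) \<and> reg \<sigma> (b+12) = 0 \<and>
      (\<forall>x<b. reg \<sigma> x = reg ?init x \<and> arr \<sigma> x = arr ?init x) \<and>
      (\<forall>p. m \<le> p \<and> p < n * n \<longrightarrow> arr \<sigma> b p = ?G p) \<and>
      (\<forall>p. m \<le> p \<and> p < n * n + n \<longrightarrow> arr \<sigma> (b+3) p = ?S p)" for m and \<sigma> :: ram_state
  have loop1: "wp W (For (b+11) (b+8) (tabulate b)) (\<lambda>t \<sigma>. t \<le> n * n * 13 + 2 \<and> J1 0 \<sigma>) \<sigma>"
    if \<sigma>: "J1 (n * n) \<sigma>" for \<sigma>
  proof (rule wp_For[where m = "n * n" and K = 11 and J = J1])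
    fix p \<sigma>
    assume p: "p < n * n" and J: "J1 (Suc p) \<sigma>"
    note pf = p_facts[OF p]
    have J': "reg \<sigma> b = int n" "reg \<sigma> (b+8) = int (n * n)" "reg \<sigma> (b+12) = 0"
      "\<And>x. x < b \<Longrightarrow> reg \<sigma> x = reg ?init x" "\<And>x. x < b \<Longrightarrow> arr \<sigma> x = arr ?init x"
      "\<And>q. Suc p \<le> q \<Longrightarrow> q < n * n \<Longrightarrow> arr \<sigma> b q = ?G q"
      "\<And>q. Suc p \<le> q \<Longrightarrow> q < n * n + n \<Longrightarrow> arr \<sigma> (b+3) q = ?S q"
      using J by (auto simp: J1_def)
    have A: "arr \<sigma> 0 = row_major n f" "arr \<sigma> 1 = row_major n g"
      using J'(5)[of 0] J'(5)[of 1] b by (auto simp: init_state_def)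
    have S: "arr \<sigma> (b+3) (p + n) = (\<Sum>k=Suc (p div n)..<n. f (p mod n) k)"
      using J'(7)[of "p + n"] p n by simp
    have eq: "(\<Sum>k=Suc (p div n)..<n. f (p mod n) k) + f (p mod n) (p div n) = ?S p"
      using pf by (simp add: sum.atLeast_Suc_lessThan)
    have G: "row_major n g p = ?G p" using p by (simp add: row_major_def)
    note bnd = gW[OF pf(2,3)] fW[OF pf(3,2)] SW[OF pf(3), of "p div n"]
      SW[OF pf(3), of "Suc (p div n)"]
    have J1_step: "J1 p \<sigma>'"
      if upd: "\<And>x. x \<le> b \<or> x = b+8 \<or> x = b+12 \<Longrightarrow> reg \<sigma>' x = reg \<sigma> x"
        "\<And>x. x < b \<Longrightarrow> arr \<sigma>' x = arr \<sigma> x"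
        "arr \<sigma>' b = (arr \<sigma> b)(p := ?G p)" "arr \<sigma>' (b+3) = (arr \<sigma> (b+3))(p := ?S p)" for \<sigma>'
      unfolding J1_def
    proof (intro conjI allI impI)
      show "reg \<sigma>' b = int n" "reg \<sigma>' (b+8) = int (n * n)" "reg \<sigma>' (b+12) = 0"
        using upd(1) J' by auto
      show "reg \<sigma>' x = reg ?init x" "arr \<sigma>' x = arr ?init x" if "x < b" for x
        using upd(1)[of x] upd(2)[of x] J'(4,5)[of x] that by auto
      show "arr \<sigma>' b q = ?G q" if "p \<le> q \<and> q < n * n" for q
        using J'(6)[of q] that by (cases "q = p") (auto simp: upd)
      show "arr \<sigma>' (b+3) q = ?S q" if "p \<le> q \<and> q < n * n + n" for q
        using J'(7)[of q] that by (cases "q = p") (auto simp: upd)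
    qed
    show "wp W (tabulate b) (\<lambda>u \<sigma>'. reg \<sigma>' (b+11) = int p \<and> J1 p \<sigma>' \<and> u \<le> 11)
       (\<sigma>\<lparr>reg := (reg \<sigma>)(b+11 := int p)\<rparr>)"
      using b pf bnd J'(1-3) A S eq G p
      apply (simp add: tabulate_def nat_int_add flip: zdiv_int zmod_int)
      apply (rule J1_step)
         apply auto
      done
  qed (use \<sigma> W1 in \<open>auto simp: J1_def\<close>)
  \<comment> \<open>Array 1 is described at every index, including the zeros from
    \<open>n * n\<close> on, because \<open>agree_below\<close> compares whole arrays.\<close>
  define J2 where "J2 m \<sigma> \<longleftrightarrow> tables n f g b \<sigma> \<and> reg \<sigma> (b+8) = int (n * n) \<and> reg \<sigma> (b+12) = 0 \<and>
      (\<forall>x<b. reg \<sigma> x = reg ?init x \<and> (x \<noteq> 1 \<longrightarrow> arr \<sigma> x = arr ?init x)) \<and>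
      arr \<sigma> 1 = (\<lambda>p. if p < m \<or> n * n \<le> p then row_major n g p else g (p mod n) (p div n))" for m and \<sigma> :: ram_state
  have loop2: "wp W (For (b+11) (b+8) (transpose_cell b)) (\<lambda>t \<sigma>. t \<le> n * n * 8 + 2 \<and> J2 0 \<sigma>) \<sigma>"
    if \<sigma>: "J2 (n * n) \<sigma>" for \<sigma>
  proof (rule wp_For[where m = "n * n" and K = 6 and J = J2])
    fix p \<sigma>
    assume p: "p < n * n" and J: "J2 (Suc p) \<sigma>"
    note pf = p_facts[OF p]
    have V: "arr \<sigma> b (p mod n * n + p div n) = g (p mod n) (p div n)" "reg \<sigma> b = int n"
      using J pf by (auto simp: J2_def tables_def)
    note bnd = gW[OF pf(3,2)]
    show "wp W (transpose_cell b) (\<lambda>u \<sigma>'. reg \<sigma>' (b+11) = int p \<and> J2 p \<sigma>' \<and> u \<le> 6)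
       (\<sigma>\<lparr>reg := (reg \<sigma>)(b+11 := int p)\<rparr>)"
      using b pf bnd J V p
      by (auto simp: transpose_cell_def J2_def tables_def fun_eq_iff simp flip: zdiv_int zmod_int)
  qed (use \<sigma> W1 in \<open>auto simp: J2_def tables_def\<close>)
  have J1J2: "J2 (n * n) \<sigma>" if "J1 0 \<sigma>" for \<sigma>
    using that b n unfolding J1_def J2_def tables_def
    by (auto simp: index_bound init_state_def trans_less_add1)
  have J2_fin: "tables n f g b \<sigma> \<and> reg \<sigma> (b+12) = 0 \<and>
      agree_below b (init_state n f (\<lambda>i j. g j i)) \<sigma>" if "J2 0 \<sigma>" for \<sigma>
    using that b unfolding J2_def agree_below_def
    by (auto simp: init_state_def row_major_def fun_eq_iff)
  \<comment> \<open>An index in the extra row has quotient \<open>n\<close>, so the claimed sum is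
    empty and agrees with the initial 0.\<close>
  have "J1 (n * n) (?init\<lparr>reg := (reg ?init)(b := int n, b + 8 := int n * int n)\<rparr>)"
    using b by (auto simp: J1_def init_state_def div_nat_eqI)
  then show ?thesis
    unfolding build_tables_def
    using W1 b apply (simp add: init_state_def[of n f g])
    apply (rule wp_mono[OF loop1])
     apply (simp add: init_state_def)
    apply (elim conjE)
    apply (rule wp_mono[OF loop2[OF J1J2]])
     apply assumption
    apply (auto dest: J2_fin)
    done
qed

section \<open>One online round: start from the predicted product and correct it at the
  jumps\<close>

section \<open>Answering a query\<close>

definition initialise :: "nat \<Rightarrow> com" where
  "initialise b = For (b+4) b
     (Seq (Op (b+7) Mul (Reg (b+4)) (Reg b)) (Seq (Op (b+7) Add (Reg (b+7)) (Reg (b+12)))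
     (Seq (Load (b+5) 2 (Reg (b+7))) (Store 4 (Reg (b+4)) (Reg (b+5))))))"

definition add_column :: "nat \<Rightarrow> com" where
  "add_column b = For (b+4) b
     (Seq (Op (b+7) Mul (Reg (b+3)) (Reg b)) (Seq (Op (b+7) Add (Reg (b+7)) (Reg (b+4)))
     (Seq (Load (b+6) (b+3) (Reg (b+7))) (Seq (Op (b+6) Mul (Reg (b+6)) (Reg (b+8)))
     (Seq (Load (b+5) 4 (Reg (b+4))) (Seq (Op (b+5) Add (Reg (b+5)) (Reg (b+6)))
     (Store 4 (Reg (b+4)) (Reg (b+5)))))))))"

text \<open>The counter falls but positions must rise, hence position \<open>n - 1 - counter\<close>
  in register \<open>b + 3\<close>. Register \<open>b + 9\<close> remembers the last difference and
  \<open>b + 8\<close> receives the jump; a column is added only if the jump is nonzero.\<close>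

definition scan_position :: "nat \<Rightarrow> com" where
  "scan_position b =
     Seq (Op (b+3) Sub (Reg b) (Reg (b+11))) (Seq (Op (b+3) Sub (Reg (b+3)) (Const 1))
     (Seq (Op (b+7) Add (Reg (b+10)) (Reg (b+3))) (Seq (Load (b+5) b (Reg (b+7)))
     (Seq (Load (b+6) 3 (Reg (b+3))) (Seq (Op (b+5) Sub (Reg (b+6)) (Reg (b+5)))
     (Seq (Op (b+8) Sub (Reg (b+5)) (Reg (b+9))) (Seq (Op (b+9) Add (Reg (b+5)) (Const 0))
     (Cond (Reg (b+8)) (add_column b) Skip))))))))"

definition query :: "nat \<Rightarrow> com" where
  "query b = Seq (initialise b) (Seq (Op (b+9) Add (Const 0) (Const 0))
     (Seq (Op (b+10) Mul (Reg (b+12)) (Reg b)) (Seq (For (b+11) b (scan_position b))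
     (Op (b+12) Add (Reg (b+12)) (Const 1)))))"

definition booleanise :: "nat \<Rightarrow> com" where
  "booleanise b = For (b+4) b
     (Seq (Load (b+5) 4 (Reg (b+4))) (Seq (Op (b+5) Less (Const 0) (Reg (b+5)))
     (Store 4 (Reg (b+4)) (Reg (b+5)))))"

text \<open>The invariant between rounds: column \<open>i\<close> of array 2 is the product of the
  matrix with prediction \<open>i\<close>.\<close>

definition ready :: "nat \<Rightarrow> (nat \<Rightarrow> nat \<Rightarrow> int) \<Rightarrow> (nat \<Rightarrow> nat \<Rightarrow> int) \<Rightarrow> nat \<Rightarrow> nat \<Rightarrow> ram_state \<Rightarrow> bool" where
  "ready n f g b i \<sigma> \<longleftrightarrow> tables n f g b \<sigma> \<and> reg \<sigma> (b+12) = int i \<and>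
     (\<forall>a<n. \<forall>i<n. arr \<sigma> 2 (a * n + i) = (\<Sum>j<n. f a j * g i j))"

text \<open>With the next two lemmas, \<open>simp\<close> strips irrelevant updates from a state one
  by one until the original state remains.\<close>

lemma ram_state_update_id [simp]:
  "(\<sigma>::ram_state)\<lparr>reg := reg \<sigma>\<rparr> = \<sigma>" "(\<sigma>::ram_state)\<lparr>reg := h, arr := arr \<sigma>\<rparr> = \<sigma>\<lparr>reg := h\<rparr>"
  by simp_all

lemma ready_update_reg [simp]:
  "r \<noteq> b \<Longrightarrow> r \<noteq> b + 12 \<Longrightarrow>
    ready n f g b i (\<sigma>\<lparr>reg := h(r := x)\<rparr>) = ready n f g b i (\<sigma>\<lparr>reg := h\<rparr>)"
  by (simp add: ready_def tables_def)

lemma ready_update_arr [simp]: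
  "A \<noteq> b \<Longrightarrow> A \<noteq> b + 3 \<Longrightarrow> A \<noteq> 2 \<Longrightarrow>
    ready n f g b i (\<sigma>\<lparr>arr := h(A := y)\<rparr>) = ready n f g b i (\<sigma>\<lparr>arr := h\<rparr>)"
  by (simp add: ready_def tables_def)

text \<open>The default 0 before the first position makes a nonzero first difference count as a
  jump.\<close>

definition previous :: "(nat \<Rightarrow> int) \<Rightarrow> nat \<Rightarrow> int" where
  "previous x j = (if j = 0 then 0 else x (j - 1))"

definition jumps :: "(nat \<Rightarrow> int) \<Rightarrow> nat \<Rightarrow> nat" where
  "jumps x m = (\<Sum>j<m. of_bool (x j \<noteq> previous x j))"

lemma wp_initialise:
  assumes "b \<ge> 5" "ready n f g b i \<sigma>" "i < n"
    and W: "int n * int n + 4 * int n + 4 \<le> W"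
    and s: "\<And>a. a < n \<Longrightarrow> \<bar>\<Sum>j<n. f a j * g i j\<bar> \<le> W"
  shows "wp W (initialise b) (\<lambda>t \<sigma>'. t \<le> n * 6 + 2 \<and> ready n f g b i \<sigma>' \<and> arr \<sigma>' 3 = arr \<sigma> 3 \<and>
      (\<forall>a<n. arr \<sigma>' 4 a = (\<Sum>j<n. f a j * g i j))) \<sigma>"
  unfolding initialise_def
proof (rule wp_For[where m = n and K = 4 and J = "\<lambda>m \<sigma>'. ready n f g b i \<sigma>' \<and> arr \<sigma>' 3 = arr \<sigma> 3 \<and>
      (\<forall>a. m \<le> a \<and> a < n \<longrightarrow> arr \<sigma>' 4 a = (\<Sum>j<n. f a j * g i j))"], goal_cases)
  case (4 a \<sigma>')
  have nn: "0 \<le> int n * int n" by simp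
  have r: "reg \<sigma>' b = int n" "reg \<sigma>' (b+12) = int i" "arr \<sigma>' 2 (a * n + i) = (\<Sum>j<n. f a j * g i j)"
    using 4 assms by (auto simp: ready_def tables_def)
  have "int a * int n + int i \<le> W" "int a * int n \<le> W" "int a \<le> W"
    using index_bound_int[of a n i] 4 assms(3) W nn by linarith+
  then show ?case using 4 r assms(1,3) s[of a] by (auto simp: Suc_le_eq)
next
  case 2
  have "0 \<le> int n * int n" by simp
  then show ?case using W by linarith
qed (use assms in \<open>auto simp: ready_def tables_def\<close>)

lemma wp_add_column:
  assumes b: "b \<ge> 5" and R: "ready n f g b i \<sigma>" and j: "j < n" "reg \<sigma> (b+3) = int j"
    and W: "int n * int n + 4 * int n + 4 \<le> W"
    and s: "\<And>a. a < n \<Longrightarrow> \<bar>\<Sum>k=j..<n. f a k\<bar> \<le> W"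
      "\<And>a. a < n \<Longrightarrow> \<bar>(\<Sum>k=j..<n. f a k) * reg \<sigma> (b+8)\<bar> \<le> W"
      "\<And>a. a < n \<Longrightarrow> \<bar>arr \<sigma> 4 a\<bar> \<le> W"
      "\<And>a. a < n \<Longrightarrow> \<bar>arr \<sigma> 4 a + (\<Sum>k=j..<n. f a k) * reg \<sigma> (b+8)\<bar> \<le> W"
  shows "wp W (add_column b) (\<lambda>t \<sigma>'. t \<le> n * 9 + 2 \<and> ready n f g b i \<sigma>' \<and> arr \<sigma>' 3 = arr \<sigma> 3 \<and>
      reg \<sigma>' (b+9) = reg \<sigma> (b+9) \<and> reg \<sigma>' (b+10) = reg \<sigma> (b+10) \<and> reg \<sigma>' (b+11) = reg \<sigma> (b+11) \<and>
      (\<forall>a<n. arr \<sigma>' 4 a = arr \<sigma> 4 a + (\<Sum>k=j..<n. f a k) * reg \<sigma> (b+8))) \<sigma>"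
  unfolding add_column_def
\<comment> \<open>Rows are processed downwards: those below \<open>m\<close> still hold the old
  value, those from \<open>m\<close> on the corrected one.\<close>
proof (rule wp_For[where m = n and K = 7 and J = "\<lambda>m \<sigma>'. ready n f g b i \<sigma>' \<and> arr \<sigma>' 3 = arr \<sigma> 3 \<and>
      reg \<sigma>' (b+9) = reg \<sigma> (b+9) \<and> reg \<sigma>' (b+10) = reg \<sigma> (b+10) \<and> reg \<sigma>' (b+11) = reg \<sigma> (b+11) \<and>
      reg \<sigma>' (b+8) = reg \<sigma> (b+8) \<and> reg \<sigma>' (b+3) = int j \<and>
      (\<forall>a<m. arr \<sigma>' 4 a = arr \<sigma> 4 a) \<and>
      (\<forall>a. m \<le> a \<and> a < n \<longrightarrow> arr \<sigma>' 4 a = arr \<sigma> 4 a + (\<Sum>k=j..<n. f a k) * reg \<sigma> (b+8))"], goal_cases)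
  case (4 a \<sigma>')
  have nn: "0 \<le> int n * int n" by simp
  have r: "reg \<sigma>' b = int n" "arr \<sigma>' (b+3) (j * n + a) = (\<Sum>k=j..<n. f a k)" "arr \<sigma>' 4 a = arr \<sigma> 4 a"
    using 4 j by (auto simp: ready_def tables_def)
  have "int j * int n + int a \<le> W" "int j * int n \<le> W" "int a \<le> W"
    using index_bound_int[of j n a] 4 j W nn by linarith+
  then show ?case using 4 r b s[of a] by (auto simp: Suc_le_eq)
next
  case 2
  have "0 \<le> int n * int n" by simp
  then show ?case using W by linarith
qed (use assms in \<open>auto simp: ready_def tables_def\<close>)

text \<open>Summation by parts, carried out from left to right. Positions without a jump take
  constant time and each jump takes \<open>O(n)\<close>.\<close>

lemma wp_query:
  fixes f g :: "nat \<Rightarrow> nat \<Rightarrow> int" and w :: "nat \<Rightarrow> int"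
  assumes n: "n \<ge> 1" and b: "b \<ge> 5" and R: "ready n f g b i \<sigma>" and i: "i < n"
    and W: "int n * int n + 4 * int n + 4 \<le> W"
    and f: "\<And>i j. i < n \<Longrightarrow> j < n \<Longrightarrow> f i j \<in> {0, 1}"
    and g: "\<And>i j. i < n \<Longrightarrow> j < n \<Longrightarrow> g i j \<in> {0, 1}"
    and w: "\<And>j. j < n \<Longrightarrow> w j \<in> {0, 1}" "\<And>j. j < n \<Longrightarrow> arr \<sigma> 3 j = w j"
  shows "wp W (query b) (\<lambda>t \<sigma>'. t \<le> 25 * (n * (1 + jumps (\<lambda>j. w j - g i j) n)) \<and>
      ready n f g b (Suc i) \<sigma>' \<and> (\<forall>a<n. arr \<sigma>' 4 a = (\<Sum>j<n. f a j * w j))) \<sigma>"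
proof -
  define x where "x j = w j - g i j" for j
  let ?S = "\<lambda>a m. \<Sum>k=m..<n. f a k"
  \<comment> \<open>Invariant: the result array after \<open>m\<close> positions treats \<open>x\<close> as constant from there on.\<close>
  define val where "val m a = (\<Sum>j<n. f a j * g i j) + (\<Sum>j<m. f a j * x j) + previous x m * ?S a m" for m a
  have nn: "0 \<le> int n * int n" by simp
  have W1: "int n * int n \<le> W" "4 * int n \<le> W" "4 \<le> W" using W nn by linarith+
  have xb: "\<bar>x j\<bar> \<le> 1" if "j < n" for j using w(1)[OF that] g[OF i that] by (auto simp: x_def)
  have pb: "\<bar>previous x j\<bar> \<le> 1" if "j \<le> n" for j using xb[of "j - 1"] that by (auto simp: previous_def)
  have Sb: "0 \<le> ?S a m" "?S a m \<le> int n" if "a < n" for a m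
    using sum_bits_bounds[of m n "f a"] f that by auto
  have SW: "\<bar>?S a m\<bar> \<le> W" if "a < n" for a m using Sb[OF that, of m] W1 by linarith
  have gb: "\<bar>\<Sum>j<n. f a j * g i j\<bar> \<le> int n" if a: "a < n" for a
  proof -
    have "f a j * g i j \<in> {0, 1}" if "j < n" for j using f[OF a that] g[OF i that] by auto
    then show ?thesis
      using sum_bits_bounds[of 0 n "\<lambda>j. f a j * g i j"] by (auto simp: atLeast0LessThan)
  qed
  have fxb: "\<bar>\<Sum>j<m. f a j * x j\<bar> \<le> int n" if a: "a < n" "m \<le> n" for a m
  proof -
    have "\<bar>\<Sum>j<m. f a j * x j\<bar> \<le> (\<Sum>j<m. \<bar>f a j * x j\<bar>)" by (rule sum_abs)
    also have "\<dots> \<le> (\<Sum>j<m. 1)"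
    proof (intro sum_mono)
      fix j assume "j \<in> {..<m}"
      then have "j < n" using a by auto
      then show "\<bar>f a j * x j\<bar> \<le> 1" using f[OF a(1), of j] xb[of j] by (auto simp: abs_mult)
    qed
    finally show ?thesis using a by simp
  qed
  \<comment> \<open>Each of the three terms of \<open>val\<close> is at most \<open>n\<close> in
    absolute value, which the summand \<open>4 * n\<close> of the word range covers.\<close>
  have valb: "\<bar>val m a\<bar> \<le> W" if "a < n" "m \<le> n" for m a
  proof -
    have "\<bar>previous x m * ?S a m\<bar> \<le> 1 * int n"
      unfolding abs_mult using pb[of m] Sb[of a m] that by (intro mult_mono) auto
    then show ?thesis using gb[of a] fxb[of a m] that W1 unfolding val_def by linarith
  qed
  \<comment> \<open>Splitting column \<open>m\<close> off the suffix sum: it settles with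
    \<open>x m\<close>, and the remaining tail switches from the previous difference to
    \<open>x m\<close>. Without a jump the value stays the same.\<close>
  have val_Suc: "val m a + ?S a m * (x m - previous x m) = val (Suc m) a" if "m < n" for m a
  proof -
    have "?S a m = f a m + ?S a (Suc m)" using that by (simp add: sum.atLeast_Suc_lessThan)
    then show ?thesis by (simp add: val_def previous_def algebra_simps)
  qed
  have val_0: "val 0 a = (\<Sum>j<n. f a j * g i j)" for a by (simp add: val_def previous_def)
  have val_n: "val n a = (\<Sum>j<n. f a j * w j)" for a
    by (simp add: val_def x_def algebra_simps sum_subtractf)
  \<comment> \<open>The 12 steps per position are 8 instructions, the branch, a \<open>Skip\<close>
    and 2 for the loop; a jump may add one run of \<open>add_column\<close>.\<close>
  define I where "I k t \<sigma>' \<longleftrightarrow> ready n f g b i \<sigma>' \<and> (\<forall>j<n. arr \<sigma>' 3 j = w j) \<and>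
     reg \<sigma>' (b+9) = previous x (n - k) \<and> reg \<sigma>' (b+10) = int i * int n \<and>
     (\<forall>a<n. arr \<sigma>' 4 a = val (n - k) a) \<and> t \<le> (n - k) * 12 + jumps x (n - k) * (n * 9 + 2)"
    for k t \<sigma>'
  have I_mono: "I k t \<sigma>' \<Longrightarrow> t' \<le> t \<Longrightarrow> I k t' \<sigma>'" for k t t' \<sigma>'
    by (auto simp: I_def)
  have scan: "wp W (scan_position b) (\<lambda>u \<sigma>'. reg \<sigma>' (b+11) = int k \<and> I k (t + u + 2) \<sigma>')
     (\<sigma>\<lparr>reg := (reg \<sigma>)(b+11 := int k)\<rparr>)"
    if k: "k < n" and "I (Suc k) t \<sigma>" for k t \<sigma>
  proof -
    define m where "m = n - Suc k"
    have m: "m < n" "n - k = Suc m" "n - Suc k = m" "int n - int k - 1 = int m"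
      "int n - int k = int m + 1"
      using k by (auto simp: m_def)
    have I: "ready n f g b i \<sigma>" "\<forall>j<n. arr \<sigma> 3 j = w j"
     "reg \<sigma> (b+9) = previous x m" "reg \<sigma> (b+10) = int i * int n"
     "\<forall>a<n. arr \<sigma> 4 a = val m a" "t \<le> m * 12 + jumps x m * (n * 9 + 2)"
      using that(2) by (auto simp: I_def m)
    have r: "reg \<sigma> b = int n" "arr \<sigma> b (i * n + m) = g i m" "arr \<sigma> 3 m = w m"
      using I(1,2) i m by (auto simp: ready_def tables_def)
    have bd: "int m + 1 \<le> W" "int i * int n + int m \<le> W"
      using index_bound_int[of i n m] i m(1) W1 by linarith+
    have vb: "\<bar>g i m\<bar> \<le> W" "\<bar>w m\<bar> \<le> W" "\<bar>w m - g i m\<bar> \<le> W" "\<bar>w m - g i m - previous x m\<bar> \<le> W"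
      using g[OF i m(1)] w(1)[OF m(1)] xb[OF m(1)] pb[of m] m(1) W1 by (auto simp: x_def)
    have jS: "jumps x (Suc m) = jumps x m + of_bool (x m \<noteq> previous x m)" by (simp add: jumps_def)
    have pS: "previous x (Suc m) = w m - g i m" by (simp add: previous_def x_def)
    show ?thesis
    proof (cases "x m = previous x m")
      case True
      then have v: "val (Suc m) a = val m a" for a using val_Suc[OF m(1), of a] by simp
      show ?thesis
        unfolding scan_position_def
        using I r bd vb b k True
        by (simp add: m I_def v jS pS flip: x_def)
    next
      case False
      \<comment> \<open>The state reached by the straight-line code just before the branch.\<close>
      let ?\<tau> = "\<sigma>\<lparr>reg := (reg \<sigma>)(b + 11 := int k, b + 3 := int m, b + 7 := int i * int n + int m,
        b + 6 := w m, b + 5 := w m - g i m, b + 8 := w m - g i m - previous x m, b + 9 := w m - g i m)\<rparr>"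
      have db: "\<bar>?S a m * (w m - g i m - previous x m)\<bar> \<le> W" if "a < n" for a
      proof -
        have "\<bar>?S a m * (w m - g i m - previous x m)\<bar> \<le> int n * 2"
          unfolding abs_mult using xb[OF m(1)] pb[of m] Sb[OF that] m(1)
          by (intro mult_mono) (auto simp: x_def)
        then show ?thesis using W1 by linarith
      qed
      have "wp W (add_column b) (\<lambda>t \<sigma>'. t \<le> n * 9 + 2 \<and> ready n f g b i \<sigma>' \<and> arr \<sigma>' 3 = arr ?\<tau> 3 \<and>
        reg \<sigma>' (b+9) = reg ?\<tau> (b+9) \<and> reg \<sigma>' (b+10) = reg ?\<tau> (b+10) \<and> reg \<sigma>' (b+11) = reg ?\<tau> (b+11) \<and>
        (\<forall>a<n. arr \<sigma>' 4 a = arr ?\<tau> 4 a + ?S a m * reg ?\<tau> (b+8))) ?\<tau>"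
        by (rule wp_add_column)
         (use b I m W db valb[of _ m] valb[of _ "Suc m"] val_Suc[OF m(1)] SW
           in \<open>auto simp: x_def ready_def tables_def\<close>)
      then have "wp W (add_column b) (\<lambda>u \<sigma>'. reg \<sigma>' (b+11) = int k \<and> I k (t + (u + 9) + 2) \<sigma>') ?\<tau>"
      proof (rule wp_mono, goal_cases)
        case (1 u \<sigma>')
        then show ?case using I False val_Suc[OF m(1)]
          by (simp add: I_def m jS pS x_def algebra_simps)
      qed
      then show ?thesis
        unfolding scan_position_def
        using I r bd vb b k False
        by (auto simp: m x_def elim!: wp_mono elim: I_mono)
    qed
  qed
  have loop: "wp W (For (b+11) b (scan_position b)) (\<lambda>u \<sigma>'. u \<le> n * 12 + jumps x n * (n * 9 + 2) + 2 \<and>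
      ready n f g b i \<sigma>' \<and> (\<forall>a<n. arr \<sigma>' 4 a = (\<Sum>j<n. f a j * w j))) \<tau>"
    if I: "I n 0 \<tau>" for \<tau>
  proof (rule wp_For_timed[where I = I and m = n])
    show "reg \<tau> b = int n" using I by (auto simp: I_def ready_def tables_def)
    show "int n \<le> W" using W1 by linarith
    show "I n 0 (\<tau>\<lparr>reg := (reg \<tau>)(b + 11 := int n)\<rparr>)" using I by (simp add: I_def)
  qed (use scan in \<open>auto simp: I_def val_n\<close>)
  \<comment> \<open>Together \<open>18 * n + 7\<close> plus the jump costs; since
    \<open>n \<ge> 1\<close>, the first part is at most \<open>25 * n\<close> and each jump costs at
    most \<open>11 * n\<close>.\<close>
  have fin: "u + (t + 3) \<le> 25 * (n * (1 + jumps x n))"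
    if "t \<le> n * 12 + jumps x n * (n * 9 + 2) + 2" "u \<le> n * 6 + 2" for t u
  proof -
    have "jumps x n * (n * 9 + 2) \<le> jumps x n * (n * 11)" using n by (intro mult_le_mono2) simp
    moreover have "jumps x n * (n * 11) = 11 * (n * jumps x n)"
      "25 * (n * (1 + jumps x n)) = 25 * n + 25 * (n * jumps x n)"
      by (simp_all add: algebra_simps)
    ultimately show ?thesis using that n by linarith
  qed
  have iW: "int i * int n \<le> W" "int i + 1 \<le> W"
    using index_bound_int[of i n 0] i n W1 by linarith+
  show ?thesis
    unfolding query_def x_def[symmetric] wp_Seq
  proof (rule wp_mono[OF wp_initialise[OF b R i W]], goal_cases)
    case (1 a)
    then show ?case using gb[of a] W1 by linarith
  next
    case (2 u \<sigma>')
    then have R': "reg \<sigma>' b = int n" "reg \<sigma>' (b+12) = int i" by (auto simp: ready_def tables_def)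
    have "I n 0 (\<sigma>'\<lparr>reg := (reg \<sigma>')(b + 9 := 0, b + 10 := int i * int n)\<rparr>)"
      using 2 w by (simp add: I_def previous_def val_0)
    from loop[OF this]
    have "wp W (For (b+11) b (scan_position b)) (\<lambda>t \<sigma>''. reg \<sigma>'' (b+12) = int i \<and>
        u + (t + 3) \<le> 25 * (n * (1 + jumps x n)) \<and>
        ready n f g b (Suc i) (\<sigma>''\<lparr>reg := (reg \<sigma>'')(b + 12 := int i + 1)\<rparr>) \<and>
        (\<forall>a<n. arr \<sigma>'' 4 a = (\<Sum>j<n. f a j * w j)))
       (\<sigma>'\<lparr>reg := (reg \<sigma>')(b + 9 := 0, b + 10 := int i * int n)\<rparr>)"
      by (rule wp_mono) (use 2 fin in \<open>auto simp: ready_def tables_def\<close>)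
    then show ?case using R' iW W1
      by (auto elim!: wp_mono simp: add.commute)
  qed
qed

lemma wp_booleanise:
  assumes b: "b \<ge> 5" and R: "ready n f g b i \<sigma>"
    and W: "int n * int n + 4 * int n + 4 \<le> W"
    and s: "\<And>a. a < n \<Longrightarrow> arr \<sigma> 4 a = s a" "\<And>a. a < n \<Longrightarrow> \<bar>s a\<bar> \<le> int n"
  shows "wp W (booleanise b) (\<lambda>t \<sigma>'. t \<le> n * 5 + 2 \<and> ready n f g b i \<sigma>' \<and>
      (\<forall>a<n. arr \<sigma>' 4 a = of_bool (0 < s a))) \<sigma>"
proof -
  have "0 \<le> int n * int n" by simp
  then have W1: "int n \<le> W" "1 \<le> W" using W by linarith+
  show ?thesis
    unfolding booleanise_def
  proof (rule wp_For[where m = n and K = 3 and J = "\<lambda>m \<sigma>'. ready n f g b i \<sigma>' \<and>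
      (\<forall>a<m. arr \<sigma>' 4 a = s a) \<and>
      (\<forall>a. m \<le> a \<and> a < n \<longrightarrow> arr \<sigma>' 4 a = of_bool (0 < s a))"], goal_cases)
    case (4 a \<sigma>')
    have "\<bar>s a\<bar> \<le> W" using s(2)[of a] 4 W1 by linarith
    then show ?case using 4 b W1 by (auto simp: Suc_le_eq)
  qed (use assms W1 in \<open>auto simp: ready_def tables_def\<close>)
qed

lemma jumps_le_EH:
  assumes "u \<in> bit_vecs n" "v \<in> bit_vecs n"
  shows "int (jumps (\<lambda>j. v $ j - u $ j) n) \<le> 2 * EH (list_of_vec u) (list_of_vec v)"
proof -
  let ?xs = "map2 (-) (list_of_vec v) (list_of_vec u)"
  have dim: "dim_vec u = n" "dim_vec v = n" using assms by (auto simp: bit_vecs_def)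
  have len: "length ?xs = n" using dim by simp
  have xs: "?xs ! j = v $ j - u $ j" if "j < n" for j using that dim by (simp add: list_of_vec_index)
  have "(0 # ?xs) ! j = previous (\<lambda>j. v $ j - u $ j) j" if "j < n" for j
    using that xs[of "j - 1"] by (cases j) (auto simp: previous_def)
  then have "jumps (\<lambda>j. v $ j - u $ j) n = changes 0 ?xs"
    unfolding changes_eq_sum jumps_def len by (intro sum.cong) (auto simp: xs)
  moreover have "set (list_of_vec u) \<subseteq> {0, 1}" "set (list_of_vec v) \<subseteq> {0, 1}"
    using assms dim by (auto simp: bit_vecs_def in_set_conv_nth list_of_vec_index)
  ultimately show ?thesis using changes_le_EH[of "list_of_vec u" "list_of_vec v"] dim by simp
qed

section \<open>Assembling preprocessing and rounds, and passing to the exponent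
  \<open>omega\<close>\<close>

section \<open>Online matrix-vector multiplication\<close>

lemma word_bound_ge:
  assumes "2 \<le> k"
  shows "int n * int n + 4 * int n + 4 \<le> word_bound k n"
proof -
  have "int n * int n + 4 * int n + 4 = word_bound 2 n"
    by (simp add: word_bound_def power2_eq_square algebra_simps)
  then show ?thesis using word_bound_mono[OF assms] by simp
qed

text \<open>Abstracts from the query program \<open>R\<close>, so that integer and Boolean answers
  share one preprocessing program and one argument. Entries are bits, so the multiplication program
  for \<open>d = 0\<close> suffices; \<open>\<tau> \<ge> 2\<close> absorbs the tabulation.\<close>

lemma omv_with_predictionsI:
  assumes prog: "mat_mult_program 0 \<tau> c k C" and \<tau>: "2 \<le> \<tau>" "\<tau> \<le> \<tau>'"
    and c: "names_below b c" and b: "b \<ge> 5" and k': "k \<le> k'" "2 \<le> k'"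
    and step: "\<And>n M g i w \<sigma>. n \<ge> 1 \<Longrightarrow> M \<in> bit_mats n \<Longrightarrow> \<forall>i<n. g i \<in> bit_vecs n \<Longrightarrow> i < n \<Longrightarrow>
      w \<in> bit_vecs n \<Longrightarrow> ready n (\<lambda>i j. M $$ (i, j)) (\<lambda>i j. g i $ j) b i \<sigma> \<Longrightarrow>
      wp (word_bound k' n) R (\<lambda>t \<sigma>'. t \<le> 32 * (n * (1 + jumps (\<lambda>j. w $ j - g i $ j) n)) \<and>
        ready n (\<lambda>i j. M $$ (i, j)) (\<lambda>i j. g i $ j) b (Suc i) \<sigma>' \<and> answer n \<sigma>' = prd M w) (deliver n w \<sigma>)"
  shows "omv_with_predictions prd \<tau>' (Seq (build_tables b) c) R k' (\<bar>C\<bar> + 64)"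
  unfolding omv_with_predictions_def
proof (intro allI ballI impI)
  fix n M and g :: "nat \<Rightarrow> int vec"
  assume n: "1 \<le> n" and M: "M \<in> bit_mats n" and g: "\<forall>i<n. g i \<in> bit_vecs n"
  let ?f = "\<lambda>i j. M $$ (i, j)" and ?g = "\<lambda>i j. g i $ j"
  let ?W = "word_bound k' n"
  define B where "B = mat n n (\<lambda>(i, j). g j $ i)"
  have fM: "M \<in> carrier_mat n n" "\<And>i j. i < n \<Longrightarrow> j < n \<Longrightarrow> ?f i j \<in> {0, 1}"
    using M by (auto simp: bit_mats_def)
  have gV: "\<And>i. i < n \<Longrightarrow> dim_vec (g i) = n" "\<And>i j. i < n \<Longrightarrow> j < n \<Longrightarrow> ?g i j \<in> {0, 1}"
    using g by (auto simp: bit_vecs_def)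
  have init_eq: "init_state n ?f (\<lambda>i j. B $$ (i, j)) = init_state n ?f (\<lambda>i j. ?g j i)"
    using n by (auto simp: init_state_def row_major_def B_def fun_eq_iff less_mult_imp_div_less)
  have "wp ?W (build_tables b) (\<lambda>t \<sigma>. t \<le> n * n * 21 + 6 \<and> tables n ?f ?g b \<sigma> \<and>
      reg \<sigma> (b+12) = 0 \<and> agree_below b (init_state n ?f (\<lambda>i j. ?g j i)) \<sigma>) (init_state n ?f ?g)"
    by (rule wp_build_tables) (use n b fM gV word_bound_ge[OF k'(2)] in auto)
  then obtain t1 \<sigma>1 where 1: "exec ?W (build_tables b) (init_state n ?f ?g) t1 \<sigma>1"
    "t1 \<le> n * n * 21 + 6" "tables n ?f ?g b \<sigma>1" "reg \<sigma>1 (b+12) = 0"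
    "agree_below b (init_state n ?f (\<lambda>i j. ?g j i)) \<sigma>1"
    by (auto simp: wp_def)
  obtain t2 \<sigma>2 where 2: "exec (word_bound k n) c (init_state n ?f (\<lambda>i j. B $$ (i, j))) t2 \<sigma>2"
    "real t2 \<le> C * real n powr \<tau>" "\<forall>i<n. \<forall>j<n. arr \<sigma>2 2 (i * n + j) = (M * B) $$ (i, j)"
  proof (rule mat_mult_programD[OF prog n fM(1), of B])
    show "B \<in> carrier_mat n n" by (simp add: B_def)
    show "\<bar>M $$ (i, j)\<bar> \<le> int n ^ 0" "\<bar>B $$ (i, j)\<bar> \<le> int n ^ 0" if "i < n" "j < n" for i j
      using fM(2)[OF that] gV(2)[OF that(2,1)] that by (auto simp: B_def)
  qed
  \<comment> \<open>The guaranteed run from a fresh start is replayed from \<open>\<sigma>1\<close>,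
    which agrees with that start below \<open>b\<close>.\<close>
  obtain \<sigma>3 where 3: "exec ?W c \<sigma>1 t2 \<sigma>3" "agree_below b \<sigma>2 \<sigma>3" "agree_above b \<sigma>3 \<sigma>1"
    using exec_frame[OF exec_mono_word[OF 2(1) word_bound_mono[OF k'(1)]] c] 1(5) init_eq by metis
  have "arr \<sigma>3 2 = arr \<sigma>2 2" using 3(2) b by (simp add: agree_below_def)
  then have prod: "arr \<sigma>3 2 (a * n + i) = (\<Sum>j<n. ?f a j * ?g i j)" if "a < n" "i < n" for a i
    using 2(3) that fM(1) by (simp add: B_def scalar_prod_def atLeast0LessThan)
  have ready0: "ready n ?f ?g b 0 \<sigma>3"
    using 1(3,4) 3(3) prod unfolding ready_def tables_def agree_above_def by simp
  have time: "real (t1 + t2) \<le> (\<bar>C\<bar> + 64) * real n powr \<tau>'"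
  proof -
    have "real n * real n = real n powr 2" using n by (simp add: power2_eq_square)
    also have "\<dots> \<le> real n powr \<tau>'" using n \<tau> by (intro powr_mono) auto
    finally have n2: "real n * real n \<le> real n powr \<tau>'" .
    have n1: "1 \<le> real n * real n" using n by (metis of_nat_1 of_nat_le_iff of_nat_mult mult_le_mono mult_1)
    have "real t1 \<le> real (n * n * 21 + 6)" using 1(2) by (rule of_nat_mono)
    also have "\<dots> \<le> 64 * real n powr \<tau>'" using n1 n2 by simp
    finally have "real t1 \<le> 64 * real n powr \<tau>'" .
    moreover have "C * real n powr \<tau> \<le> \<bar>C\<bar> * real n powr \<tau>'"
      using n \<tau> by (intro mult_mono powr_mono) auto
    ultimately show ?thesis using 2(2) by (simp add: distrib_right)
  qed
  show "\<exists>t0 \<sigma>0. exec ?W (Seq (build_tables b) c) (init_state n ?f ?g) t0 \<sigma>0 \<and>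
      real t0 \<le> (\<bar>C\<bar> + 64) * real n powr \<tau>' \<and>
      (\<forall>\<Delta>::real. \<forall>v. 0 \<le> \<Delta> \<and> \<Delta> \<le> real n \<and>
         (\<forall>i<n. v i \<in> bit_vecs n \<and>
            real_of_int (EH (list_of_vec (g i)) (list_of_vec (v i))) \<le> \<Delta>) \<longrightarrow>
         (\<exists>t \<sigma>. \<sigma> 0 = \<sigma>0 \<and>
           (\<forall>i<n. exec ?W R (deliver n (v i) (\<sigma> i)) (t i) (\<sigma> (Suc i)) \<and>
              real (t i) \<le> (\<bar>C\<bar> + 64) * (real n * (1 + \<Delta>)) \<and>
              answer n (\<sigma> (Suc i)) = prd M (v i))))"
  proof (rule exI[of _ "t1 + t2"], rule exI[of _ \<sigma>3], intro conjI allI impI)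
    show "exec ?W (Seq (build_tables b) c) (init_state n ?f ?g) (t1 + t2) \<sigma>3"
      using 1(1) 3(1) by (rule exec_Seq)
    show "real (t1 + t2) \<le> (\<bar>C\<bar> + 64) * real n powr \<tau>'" by (rule time)
  next
    fix \<Delta> :: real and v :: "nat \<Rightarrow> int vec"
    assume H: "0 \<le> \<Delta> \<and> \<Delta> \<le> real n \<and> (\<forall>i<n. v i \<in> bit_vecs n \<and>
            real_of_int (EH (list_of_vec (g i)) (list_of_vec (v i))) \<le> \<Delta>)"
    let ?good = "\<lambda>i \<sigma> t \<sigma>'. exec ?W R (deliver n (v i) \<sigma>) t \<sigma>' \<and>
              real t \<le> (\<bar>C\<bar> + 64) * (real n * (1 + \<Delta>)) \<and> answer n \<sigma>' = prd M (v i)"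
    have round: "\<exists>t \<sigma>'. ?good i \<sigma> t \<sigma>' \<and> ready n ?f ?g b (Suc i) \<sigma>'"
      if i: "i < n" and r: "ready n ?f ?g b i \<sigma>" for i \<sigma>
    proof -
      have v: "v i \<in> bit_vecs n" and EH: "real_of_int (EH (list_of_vec (g i)) (list_of_vec (v i))) \<le> \<Delta>"
        using H i by auto
      obtain t \<sigma>' where t: "exec ?W R (deliver n (v i) \<sigma>) t \<sigma>'"
        "t \<le> 32 * (n * (1 + jumps (\<lambda>j. v i $ j - g i $ j) n))"
        "ready n ?f ?g b (Suc i) \<sigma>'" "answer n \<sigma>' = prd M (v i)"
        using step[OF n M g i v r] by (auto simp: wp_def)
      have J: "real (jumps (\<lambda>j. v i $ j - g i $ j) n) \<le> 2 * \<Delta>"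
      proof -
        have "real_of_int (int (jumps (\<lambda>j. v i $ j - g i $ j) n))
            \<le> real_of_int (2 * EH (list_of_vec (g i)) (list_of_vec (v i)))"
          using jumps_le_EH[of "g i" n "v i"] g i v by (simp only: of_int_le_iff)
        then show ?thesis using EH by simp
      qed
      have "real t \<le> real (32 * (n * (1 + jumps (\<lambda>j. v i $ j - g i $ j) n)))"
        using t(2) by (rule of_nat_mono)
      also have "\<dots> = 32 * (real n * (1 + real (jumps (\<lambda>j. v i $ j - g i $ j) n)))" by (simp add: algebra_simps)
      \<comment> \<open>From at most \<open>2 * \<Delta>\<close> jumps,
        \<open>1 + 2 * \<Delta> \<le> 2 * (1 + \<Delta>)\<close>; this doubling gives the constant
        64.\<close>
      also have "\<dots> \<le> 32 * (real n * (2 * (1 + \<Delta>)))"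
        using J by (intro mult_left_mono) auto
      also have "\<dots> = 64 * (real n * (1 + \<Delta>))" by simp
      also have "\<dots> \<le> (\<bar>C\<bar> + 64) * (real n * (1 + \<Delta>))"
        using H by (intro mult_right_mono) auto
      finally show ?thesis using t by blast
    qed
    \<comment> \<open>The rounds are chained by dependent choice, which yields an infinite sequence;
      the guards leave the states after round \<open>n\<close> arbitrary.\<close>
    have "\<exists>\<sigma>. \<forall>i. (i \<le> n \<longrightarrow> ready n ?f ?g b i (\<sigma> i)) \<and> (i = 0 \<longrightarrow> \<sigma> i = \<sigma>3) \<and>
        (i < n \<longrightarrow> (\<exists>t. ?good i (\<sigma> i) t (\<sigma> (Suc i))))"
    proof -
      have "\<exists>\<sigma>. \<forall>i. ((i \<le> n \<longrightarrow> ready n ?f ?g b i (\<sigma> i)) \<and> (i = 0 \<longrightarrow> \<sigma> i = \<sigma>3)) \<and>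
          (i < n \<longrightarrow> (\<exists>t. ?good i (\<sigma> i) t (\<sigma> (Suc i))))"
      proof (rule dependent_nat_choice)
        show "\<exists>\<sigma>. (0 \<le> n \<longrightarrow> ready n ?f ?g b 0 \<sigma>) \<and> (0 = (0::nat) \<longrightarrow> \<sigma> = \<sigma>3)"
          using ready0 by blast
        show "\<exists>\<sigma>'. ((Suc i \<le> n \<longrightarrow> ready n ?f ?g b (Suc i) \<sigma>') \<and> (Suc i = 0 \<longrightarrow> \<sigma>' = \<sigma>3)) \<and>
            (i < n \<longrightarrow> (\<exists>t. ?good i \<sigma> t \<sigma>'))"
          if "(i \<le> n \<longrightarrow> ready n ?f ?g b i \<sigma>) \<and> (i = 0 \<longrightarrow> \<sigma> = \<sigma>3)" for \<sigma> i
        proof (cases "i < n")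
          case True
          then show ?thesis using round[OF True, of \<sigma>] that by auto
        next
          case False
          then show ?thesis by auto
        qed
      qed
      then show ?thesis by (simp add: conj_assoc)
    qed
    then obtain \<sigma> where "\<sigma> 0 = \<sigma>3" "\<forall>i<n. \<exists>t. ?good i (\<sigma> i) t (\<sigma> (Suc i))" by blast
    moreover then obtain t where "\<forall>i<n. ?good i (\<sigma> i) (t i) (\<sigma> (Suc i))" by metis
    ultimately show "\<exists>t \<sigma>. \<sigma> 0 = \<sigma>3 \<and> (\<forall>i<n. ?good i (\<sigma> i) (t i) (\<sigma> (Suc i)))" by blast
  qed
qed

text \<open>Delivery touches array 3 only, about which \<open>ready\<close> says nothing as
  \<open>b \<ge> 5\<close>.\<close>

lemma wp_query_deliver:
  assumes b: "b \<ge> 5" and k: "2 \<le> k" and n: "n \<ge> 1" and M: "M \<in> bit_mats n"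
    and g: "\<forall>i<n. g i \<in> bit_vecs n" and i: "i < n" and w: "w \<in> bit_vecs n"
    and r: "ready n (\<lambda>i j. M $$ (i, j)) (\<lambda>i j. g i $ j) b i \<sigma>"
  shows "wp (word_bound k n) (query b) (\<lambda>t \<sigma>'. t \<le> 25 * (n * (1 + jumps (\<lambda>j. w $ j - g i $ j) n)) \<and>
      ready n (\<lambda>i j. M $$ (i, j)) (\<lambda>i j. g i $ j) b (Suc i) \<sigma>' \<and>
      (\<forall>a<n. arr \<sigma>' 4 a = (\<Sum>j<n. M $$ (a, j) * w $ j))) (deliver n w \<sigma>)"
proof (rule wp_query[OF n b _ i word_bound_ge[OF k]])
  show "ready n (\<lambda>i j. M $$ (i, j)) (\<lambda>i j. g i $ j) b i (deliver n w \<sigma>)"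
    using r b by (simp add: deliver_def ready_def tables_def)
qed (use M g w in \<open>auto simp: bit_mats_def bit_vecs_def deliver_def\<close>)

lemma mult_mat_vec_answer:
  assumes "M \<in> carrier_mat n n" "w \<in> carrier_vec n" "\<forall>a<n. arr \<sigma> 4 a = (\<Sum>j<n. M $$ (a, j) * w $ j)"
  shows "answer n \<sigma> = M *\<^sub>v w"
  using assms by (intro eq_vecI) (auto simp: answer_def scalar_prod_def atLeast0LessThan)

text \<open>Nonnegative summands cannot cancel, so the Boolean product is the integer product
  compared with 0.\<close>

lemma sum_bits_pos_iff:
  fixes p q :: "nat \<Rightarrow> int"
  assumes p: "\<And>j. j < n \<Longrightarrow> p j \<in> {0, 1}" and q: "\<And>j. j < n \<Longrightarrow> q j \<in> {0, 1}"
  shows "0 < (\<Sum>j<n. p j * q j) \<longleftrightarrow> (\<exists>j<n. p j = 1 \<and> q j = 1)"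
proof -
  have bit: "0 \<le> p j * q j" "p j * q j = 0 \<longleftrightarrow> \<not> (p j = 1 \<and> q j = 1)" if "j < n" for j
    using p[OF that] q[OF that] by auto
  have "0 \<le> (\<Sum>j<n. p j * q j)" by (rule sum_nonneg) (use bit(1) in simp)
  then have "0 < (\<Sum>j<n. p j * q j) \<longleftrightarrow> \<not> (\<Sum>j<n. p j * q j) = 0" by linarith
  also have "(\<Sum>j<n. p j * q j) = 0 \<longleftrightarrow> (\<forall>j\<in>{..<n}. p j * q j = 0)"
    by (rule sum_nonneg_eq_0_iff) (use bit(1) in simp_all)
  also have "\<dots> \<longleftrightarrow> (\<forall>j\<in>{..<n}. \<not> (p j = 1 \<and> q j = 1))"
    by (rule ball_cong[OF refl]) (use bit(2) in simp)
  finally show ?thesis by blast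
qed

text \<open>Separating the admissible \<open>\<tau>\<close> from the claimed \<open>\<tau>'\<close>
  serves both an infimum that is only approached and one that is attained. The Boolean round costs
  \<open>5 * n + 2\<close> more, which the constant \<open>32 = 25 + 5 + 2\<close> allows
  for.\<close>

lemma ex_omv_with_predictions:
  assumes "mat_mult_time \<tau>" "\<tau> \<le> \<tau>'"
  shows "\<exists>P Q R k C. omv_with_predictions (*\<^sub>v) \<tau>' P Q k C \<and>
            omv_with_predictions bool_mult_mat_vec \<tau>' P R k C"
proof -
  obtain c k C where prog: "mat_mult_program 0 \<tau> c k C"
    using assms(1) unfolding mat_mult_time_iff by blast
  obtain b0 where "names_below b0 c" using ex_names_below by blast
  then have c: "names_below (b0 + 5) c" by (rule names_below_mono) simp
  let ?b = "b0 + 5" and ?k = "max k 2"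
  note intro = omv_with_predictionsI[OF prog mat_mult_time_ge_2[OF assms(1)] assms(2) c _
    max.cobounded1 max.cobounded2]
  have "omv_with_predictions (*\<^sub>v) \<tau>' (Seq (build_tables ?b) c) (query ?b) ?k (\<bar>C\<bar> + 64)"
  proof (rule intro, goal_cases)
    case (2 n M g i w \<sigma>)
    then have "wp (word_bound ?k n) (query ?b)
      (\<lambda>t \<sigma>'. t \<le> 25 * (n * (1 + jumps (\<lambda>j. w $ j - g i $ j) n)) \<and>
      ready n (\<lambda>i j. M $$ (i, j)) (\<lambda>i j. g i $ j) ?b (Suc i) \<sigma>' \<and>
      (\<forall>a<n. arr \<sigma>' 4 a = (\<Sum>j<n. M $$ (a, j) * w $ j))) (deliver n w \<sigma>)"
      by (intro wp_query_deliver) auto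
    then show ?case
      by (rule wp_mono)
        (use 2 in \<open>auto intro!: mult_mat_vec_answer simp: bit_mats_def bit_vecs_def\<close>)
  qed simp
  moreover have "omv_with_predictions bool_mult_mat_vec \<tau>' (Seq (build_tables ?b) c)
      (Seq (query ?b) (booleanise ?b)) ?k (\<bar>C\<bar> + 64)"
  proof (rule intro, goal_cases)
    case (2 n M g i w \<sigma>)
    let ?s = "\<lambda>a. \<Sum>j<n. M $$ (a, j) * w $ j"
    have s: "\<bar>?s a\<bar> \<le> int n" if "a < n" for a
    proof -
      have "M $$ (a, j) * w $ j \<in> {0, 1}" if "j < n" for j
        using 2(2,5) \<open>a < n\<close> that by (fastforce simp: bit_mats_def bit_vecs_def)
      then show ?thesis
        using sum_bits_bounds[of 0 n "\<lambda>j. M $$ (a, j) * w $ j"] by (auto simp: atLeast0LessThan)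
    qed
    from 2 have "wp (word_bound ?k n) (query ?b)
      (\<lambda>t \<sigma>'. t \<le> 25 * (n * (1 + jumps (\<lambda>j. w $ j - g i $ j) n)) \<and>
      ready n (\<lambda>i j. M $$ (i, j)) (\<lambda>i j. g i $ j) ?b (Suc i) \<sigma>' \<and>
      (\<forall>a<n. arr \<sigma>' 4 a = ?s a)) (deliver n w \<sigma>)"
      by (intro wp_query_deliver) auto
    then show ?case
      unfolding wp_Seq
    proof (rule wp_mono, goal_cases)
      case (1 t \<sigma>')
      have ans: "answer n \<rho> = bool_mult_mat_vec M w" if "\<forall>a<n. arr \<rho> 4 a = of_bool (0 < ?s a)" for \<rho>
        using that 2(2,5) sum_bits_pos_iff[of n "\<lambda>j. M $$ (_, j)" "\<lambda>j. w $ j"]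
        by (intro eq_vecI) (auto simp: answer_def bool_mult_mat_vec_def bit_mats_def bit_vecs_def)
      have "wp (word_bound ?k n) (booleanise ?b) (\<lambda>u \<rho>. u \<le> n * 5 + 2 \<and>
          ready n (\<lambda>i j. M $$ (i, j)) (\<lambda>i j. g i $ j) ?b (Suc i) \<rho> \<and>
          (\<forall>a<n. arr \<rho> 4 a = of_bool (0 < ?s a))) \<sigma>'"
        using 1 s by (intro wp_booleanise word_bound_ge) auto
      then show ?case
        by (rule wp_mono) (use 1 2(1) ans in \<open>auto simp: algebra_simps\<close>)
    qed
  qed simp
  ultimately show ?thesis by blast
qed

text \<open>As an infimum, \<open>omega\<close> need not itself be admissible. The bound
  \<open>O(n^omega)\<close> is therefore stated with an arbitrary \<open>\<epsilon> > 0\<close>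
  added, and exactly whenever the infimum is attained.\<close>

theorem theorem2p5:
  shows "(\<forall>\<epsilon>>0. \<exists>P Q R k C.
            omv_with_predictions (*\<^sub>v) (omega + \<epsilon>) P Q k C \<and>
            omv_with_predictions bool_mult_mat_vec (omega + \<epsilon>) P R k C) \<and>
         (mat_mult_time omega \<longrightarrow> (\<exists>P Q R k C.
            omv_with_predictions (*\<^sub>v) omega P Q k C \<and>
            omv_with_predictions bool_mult_mat_vec omega P R k C))"
proof (intro conjI allI impI)
  fix \<epsilon> :: real
  assume "0 < \<epsilon>"
  then have less: "Inf {\<tau>. mat_mult_time \<tau>} < omega + \<epsilon>" by (simp add: omega_def)
  \<comment> \<open>Nonemptiness is what allows an admissible exponent to be chosen below
    \<open>omega + \<epsilon>\<close>.\<close>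
  have ne: "{\<tau>. mat_mult_time \<tau>} \<noteq> {}" using mat_mult_time_3 by blast
  obtain \<tau> where "mat_mult_time \<tau>" "\<tau> < omega + \<epsilon>"
    using cInf_lessD[OF ne less] by blast
  then show "\<exists>P Q R k C. omv_with_predictions (*\<^sub>v) (omega + \<epsilon>) P Q k C \<and>
      omv_with_predictions bool_mult_mat_vec (omega + \<epsilon>) P R k C"
    by (rule ex_omv_with_predictions[OF _ less_imp_le])
next
  assume "mat_mult_time omega"
  then show "\<exists>P Q R k C. omv_with_predictions (*\<^sub>v) omega P Q k C \<and>
      omv_with_predictions bool_mult_mat_vec omega P R k C"
    by (rule ex_omv_with_predictions[OF _ order_refl])
qed

end
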